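(* Let $K$ be a field of characteristic $2$ and let $A$ be an associative commutative $K$-algebra with unit. For $n=1,2$, $$\mathrm{H}^n(\mathsf{S}\otimes A,\mathsf{S}\otimes A)\simeq\Big(\mathrm{H}^n(\mathsf{S},\mathsf{S})\otimes A\Big)\oplus\mathrm{Har}^n(A,A).$$
   Context: $\mathsf{S}$ is the $3$-dimensional simple Lie algebra over $K$ with basis $\{e,h,f\}$ and multiplication $[e,h]=e$, $[f,h]=f$, $[e,f]=h$. The current Lie algebra $\mathsf{S}\otimes A$ has bracket $[x\otimes a,y\otimes b]=[x,y]\otimes ab$. $\mathrm{H}^n(L,L)$ is the Chevalley--Eilenberg cohomology (with alternating cochains) of $L$ with coefficients in the adjoint module. $\mathrm{Har}^n(A,A)$ is Harrison cohomology: $\mathrm{Har}^1(A,A)=\mathrm{Der}(A)$, and $\mathrm{Har}^2(A,A)$ is the quotient of the space of symmetric Hochschild $2$-cocycles (symmetric bilinear $\beta:A\times A\to A$ with $a\beta(b,c)+\beta(ab,c)+\beta(a,bc)+\beta(a,b)c=0$) by the space of Hochschild $2$-coboundaries (maps $(a,b)\mapsto a\omega(b)+\omega(ab)+\omega(a)b$ with $\omega:A\to A$ linear). *)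

theory Defs
  imports Complex_Main "HOL-Library.Poly_Mapping" "HOL-Library.Product_Plus"
    "HOL-Library.Function_Algebras"
begin

section \<open>Vector spaces with explicit carriers\<close>

text \<open>
  Cohomology spaces and tensor products are quotients that depend on term parameters, so they
  live on carrier sets. The ground field is a type of class \<open>field\<close>.
\<close>

record ('k, 'v) vspace =
  carr :: "'v set"
  add :: "'v \<Rightarrow> 'v \<Rightarrow> 'v"
  zro :: "'v"
  scl :: "'k \<Rightarrow> 'v \<Rightarrow> 'v"

definition class_vs :: "('k \<Rightarrow> 'v \<Rightarrow> 'v) \<Rightarrow> 'v set \<Rightarrow> ('k, 'v::ab_group_add) vspace" where
  "class_vs s U = \<lparr>carr = U, add = (+), zro = 0, scl = s\<rparr>"

definition vs_iso :: "('k, 'v, 'm) vspace_scheme \<Rightarrow> ('k, 'w, 'n) vspace_scheme \<Rightarrow> bool"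
    (infix \<open>\<cong>\<^sub>K\<close> 50) where
  "V \<cong>\<^sub>K W \<longleftrightarrow> (\<exists>f. bij_betw f (carr V) (carr W) \<and>
     (\<forall>x\<in>carr V. \<forall>y\<in>carr V. f (add V x y) = add W (f x) (f y)) \<and>
     (\<forall>c. \<forall>x\<in>carr V. f (scl V c x) = scl W c (f x)))"

definition direct_sum ::
    "('k, 'v, 'm) vspace_scheme \<Rightarrow> ('k, 'w, 'n) vspace_scheme \<Rightarrow> ('k, 'v \<times> 'w) vspace"
    (infixr \<open>\<oplus>\<^sub>K\<close> 65) where
  "V \<oplus>\<^sub>K W = \<lparr>carr = carr V \<times> carr W,
     add = (\<lambda>x y. (add V (fst x) (fst y), add W (snd x) (snd y))),
     zro = (zro V, zro W),
     scl = (\<lambda>c x. (scl V c (fst x), scl W c (snd x)))\<rparr>"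

definition coset :: "('k, 'v, 'm) vspace_scheme \<Rightarrow> 'v set \<Rightarrow> 'v \<Rightarrow> 'v set" where
  "coset V N x = {add V x n | n. n \<in> N}"

text \<open>Scalar multiplication on cosets adds \<open>N\<close> again so that \<open>0 \<cdot> (x + N)\<close> is \<open>N\<close>, not \<open>{0}\<close>.\<close>

definition quotient :: "('k, 'v, 'm) vspace_scheme \<Rightarrow> 'v set \<Rightarrow> ('k, 'v set) vspace" where
  "quotient V N = \<lparr>carr = coset V N ` carr V,
     add = (\<lambda>X Y. {add V x y | x y. x \<in> X \<and> y \<in> Y}),
     zro = N,
     scl = (\<lambda>c X. \<Union>x\<in>X. coset V N (scl V c x))\<rparr>"


section \<open>Tensor products\<close>

text \<open>
  \<open>V \<otimes> W\<close> is the free vector space on \<open>V \<times> W\<close> modulo the bilinearity relations;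
  \<^term>\<open>Poly_Mapping.single (v, w) c\<close> is \<open>c\<close> times the generator \<open>(v, w)\<close>.
\<close>

abbreviation free_scale :: "'k \<Rightarrow> ('b \<Rightarrow>\<^sub>0 'k) \<Rightarrow> ('b \<Rightarrow>\<^sub>0 'k::field)" where
  "free_scale c \<equiv> Poly_Mapping.map ((*) c)"

definition free_vs :: "'b set \<Rightarrow> ('k::field, 'b \<Rightarrow>\<^sub>0 'k) vspace" where
  "free_vs B = class_vs free_scale {p. Poly_Mapping.keys p \<subseteq> B}"

definition tensor_gens ::
    "('k::field, 'v, 'm) vspace_scheme \<Rightarrow> ('k, 'w, 'n) vspace_scheme \<Rightarrow> ('v \<times> 'w \<Rightarrow>\<^sub>0 'k) set" where
  "tensor_gens V W =
     {Poly_Mapping.single (add V x y, w) 1 - Poly_Mapping.single (x, w) 1 - Poly_Mapping.single (y, w) 1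
        | x y w. x \<in> carr V \<and> y \<in> carr V \<and> w \<in> carr W} \<union>
     {Poly_Mapping.single (v, add W x y) 1 - Poly_Mapping.single (v, x) 1 - Poly_Mapping.single (v, y) 1
        | v x y. v \<in> carr V \<and> x \<in> carr W \<and> y \<in> carr W} \<union>
     {Poly_Mapping.single (scl V c v, w) 1 - Poly_Mapping.single (v, w) c
        | c v w. v \<in> carr V \<and> w \<in> carr W} \<union>
     {Poly_Mapping.single (v, scl W c w) 1 - Poly_Mapping.single (v, w) c
        | c v w. v \<in> carr V \<and> w \<in> carr W}"

definition tensor_rels ::
    "('k::field, 'v, 'm) vspace_scheme \<Rightarrow> ('k, 'w, 'n) vspace_scheme \<Rightarrow> ('v \<times> 'w \<Rightarrow>\<^sub>0 'k) set" where
  "tensor_rels V W = module.span free_scale (tensor_gens V W)"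

definition tensor ::
    "('k::field, 'v, 'm) vspace_scheme \<Rightarrow> ('k, 'w, 'n) vspace_scheme
      \<Rightarrow> ('k, ('v \<times> 'w \<Rightarrow>\<^sub>0 'k) set) vspace"
    (infixr \<open>\<otimes>\<^sub>K\<close> 70) where
  "V \<otimes>\<^sub>K W = quotient (free_vs (carr V \<times> carr W)) (tensor_rels V W)"


section \<open>The Lie algebra S and current Lie algebras\<close>

record ('k, 'v) lie_alg = "('k, 'v) vspace" +
  brk :: "'v \<Rightarrow> 'v \<Rightarrow> 'v"

text \<open>
  The triple \<open>(\<alpha>, \<beta>, \<gamma>)\<close> stands for \<open>\<alpha>e + \<beta>h + \<gamma>f\<close>. The bracket is the alternating bilinear
  extension of \<open>[e,h] = e\<close>, \<open>[f,h] = f\<close>, \<open>[e,f] = h\<close>; it satisfies the Jacobi identity in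
  characteristic 2.
\<close>

definition S_bracket :: "'k \<times> 'k \<times> 'k \<Rightarrow> 'k \<times> 'k \<times> 'k \<Rightarrow> 'k \<times> 'k \<times> 'k::field" where
  "S_bracket = (\<lambda>(a1, b1, c1) (a2, b2, c2).
     (a1 * b2 - b1 * a2, a1 * c2 - c1 * a2, c1 * b2 - b1 * c2))"

definition S_alg :: "('k::field, 'k \<times> 'k \<times> 'k) lie_alg" where
  "S_alg = vspace.extend (class_vs (\<lambda>c (x, y, z). (c * x, c * y, c * z)) UNIV)
     \<lparr>brk = S_bracket\<rparr>"

lemma S_alg_table:
  fixes e h f :: "'k::field \<times> 'k \<times> 'k"
  defines "e \<equiv> (1, 0, 0)" and "h \<equiv> (0, 1, 0)" and "f \<equiv> (0, 0, 1)"
  shows "brk S_alg e h = e" "brk S_alg f h = f" "brk S_alg e f = h"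
  by (simp_all add: e_def h_def f_def S_alg_def S_bracket_def lie_alg.defs vspace.defs class_vs_def)

lemma S_alg_jacobi:
  fixes x y z :: "'k::field \<times> 'k \<times> 'k"
  assumes "CHAR('k) = 2"
  shows "brk S_alg x x = 0"
    and "brk S_alg (brk S_alg x y) z + brk S_alg (brk S_alg y z) x + brk S_alg (brk S_alg z x) y = 0"
proof -
  have "of_nat CHAR('k) = (0::'k)" by (rule of_nat_CHAR)
  then have two: "(2::'k) = 0" using assms by simp
  have [simp]: "- a = a" for a :: 'k
  proof -
    have "a + a = 2 * a" by (rule mult_2[symmetric])
    then show ?thesis using two by (simp add: eq_neg_iff_add_eq_0 [symmetric])
  qed
  have [simp]: "a - b = a + b" for a b :: 'k
    using diff_conv_add_uminus[of a b] by simp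
  have [simp]: "a + a = 0" "a + (a + b) = b" for a b :: 'k
    using two mult_2[of a] by (simp_all add: add.assoc[symmetric])
  show "brk S_alg x x = 0"
    by (cases x) (simp add: S_alg_def S_bracket_def lie_alg.defs vspace.defs class_vs_def
        zero_prod_def mult.commute)
  show "brk S_alg (brk S_alg x y) z + brk S_alg (brk S_alg y z) x + brk S_alg (brk S_alg z x) y = 0"
    by (cases x; cases y; cases z) (simp add: S_alg_def S_bracket_def lie_alg.defs vspace.defs
        class_vs_def zero_prod_def algebra_simps)
qed

text \<open>
  \<open>free_bracket\<close> is the bilinear extension of \<open>(x, a), (y, b) \<mapsto> ([x,y], ab)\<close> to the free vector
  space; the bracket on \<open>L \<otimes> A\<close> is the one induced on classes.
\<close>

definition free_bracket ::
    "('k::field, 'v, 'm) lie_alg_scheme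
      \<Rightarrow> ('v \<times> 'a \<Rightarrow>\<^sub>0 'k) \<Rightarrow> ('v \<times> 'a \<Rightarrow>\<^sub>0 'k) \<Rightarrow> ('v \<times> 'a::times \<Rightarrow>\<^sub>0 'k)" where
  "free_bracket L p q = (\<Sum>s\<in>Poly_Mapping.keys p. \<Sum>t\<in>Poly_Mapping.keys q.
     Poly_Mapping.single (brk L (fst s) (fst t), snd s * snd t)
       (Poly_Mapping.lookup p s * Poly_Mapping.lookup q t))"

definition current ::
    "('k::field, 'v, 'm) lie_alg_scheme \<Rightarrow> ('k \<Rightarrow> 'a \<Rightarrow> 'a)
      \<Rightarrow> ('k, ('v \<times> 'a::comm_ring \<Rightarrow>\<^sub>0 'k) set) lie_alg" where
  "current L s = (let A = class_vs s UNIV in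
     vspace.extend (L \<otimes>\<^sub>K A)
       \<lparr>brk = (\<lambda>X Y. \<Union>p\<in>X. \<Union>q\<in>Y.
          coset (free_vs (carr L \<times> carr A)) (tensor_rels L A) (free_bracket L p q))\<rparr>)"


section \<open>Chevalley--Eilenberg cohomology with adjoint coefficients\<close>

text \<open>
  An \<open>n\<close>-cochain is a function on lists of length \<open>n\<close>. Cochains are \<open>0\<close> on all other lists, so
  that they are determined by their values on the relevant arguments.
\<close>

definition args :: "('k, 'v, 'm) vspace_scheme \<Rightarrow> nat \<Rightarrow> 'v list set" where
  "args L n = {xs. length xs = n \<and> set xs \<subseteq> carr L}"

definition multilinear :: "('k, 'v, 'm) vspace_scheme \<Rightarrow> nat \<Rightarrow> ('v list \<Rightarrow> 'v) \<Rightarrow> bool" where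
  "multilinear L n \<phi> \<longleftrightarrow> (\<forall>xs\<in>args L n. \<forall>i<n.
     (\<forall>x\<in>carr L. \<forall>y\<in>carr L. \<phi> (xs[i := add L x y]) = add L (\<phi> (xs[i := x])) (\<phi> (xs[i := y]))) \<and>
     (\<forall>c. \<forall>x\<in>carr L. \<phi> (xs[i := scl L c x]) = scl L c (\<phi> (xs[i := x]))))"

definition alternating :: "('k, 'v, 'm) vspace_scheme \<Rightarrow> nat \<Rightarrow> ('v list \<Rightarrow> 'v) \<Rightarrow> bool" where
  "alternating L n \<phi> \<longleftrightarrow>
     (\<forall>xs\<in>args L n. \<forall>i j. i < j \<and> j < n \<and> xs ! i = xs ! j \<longrightarrow> \<phi> xs = zro L)"

definition cochains :: "('k, 'v, 'm) vspace_scheme \<Rightarrow> nat \<Rightarrow> ('k, 'v list \<Rightarrow> 'v) vspace" where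
  "cochains L n = \<lparr>
     carr = {\<phi>. (\<forall>xs\<in>args L n. \<phi> xs \<in> carr L) \<and> (\<forall>xs. xs \<notin> args L n \<longrightarrow> \<phi> xs = zro L) \<and>
       multilinear L n \<phi> \<and> alternating L n \<phi>},
     add = (\<lambda>\<phi> \<psi> xs. add L (\<phi> xs) (\<psi> xs)),
     zro = (\<lambda>xs. zro L),
     scl = (\<lambda>c \<phi> xs. scl L c (\<phi> xs))\<rparr>"

definition vsum :: "('k, 'v, 'm) vspace_scheme \<Rightarrow> 'v list \<Rightarrow> 'v" where
  "vsum L vs = foldr (add L) vs (zro L)"

text \<open>
  With indices starting at 0,
  \<open>d\<phi>(x_0, ..., x_n) = \<Sum>_i (-1)^i [x_i, \<phi>(..., omit x_i, ...)]
     + \<Sum>_{i<j} (-1)^(i+j) \<phi>([x_i, x_j], ..., omit x_i, ..., omit x_j, ...)\<close>.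
\<close>

definition CE_diff :: "('k::field, 'v, 'm) lie_alg_scheme \<Rightarrow> nat \<Rightarrow> ('v list \<Rightarrow> 'v) \<Rightarrow> 'v list \<Rightarrow> 'v" where
  "CE_diff L n \<phi> xs = (if xs \<in> args L (Suc n) then
     add L
       (vsum L [scl L ((-1) ^ i) (brk L (xs ! i) (\<phi> (nths xs (- {i})))). i \<leftarrow> [0..<Suc n]])
       (vsum L [scl L ((-1) ^ (i + j)) (\<phi> (brk L (xs ! i) (xs ! j) # nths xs (- {i, j}))).
          j \<leftarrow> [0..<Suc n], i \<leftarrow> [0..<j]])
     else zro L)"

definition CE_cocycles :: "('k::field, 'v, 'm) lie_alg_scheme \<Rightarrow> nat \<Rightarrow> ('v list \<Rightarrow> 'v) set" where
  "CE_cocycles L n = {\<phi> \<in> carr (cochains L n). \<forall>xs. CE_diff L n \<phi> xs = zro L}"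

definition CE_coboundaries :: "('k::field, 'v, 'm) lie_alg_scheme \<Rightarrow> nat \<Rightarrow> ('v list \<Rightarrow> 'v) set" where
  "CE_coboundaries L n = (case n of
     0 \<Rightarrow> {\<lambda>xs. zro L} | Suc m \<Rightarrow> CE_diff L m ` carr (cochains L m))"

definition CE_cohomology ::
    "('k::field, 'v, 'm) lie_alg_scheme \<Rightarrow> nat \<Rightarrow> ('k, ('v list \<Rightarrow> 'v) set) vspace" where
  "CE_cohomology L n = quotient (cochains L n\<lparr>carr := CE_cocycles L n\<rparr>) (CE_coboundaries L n)"


section \<open>Harrison cohomology in degrees 1 and 2\<close>

text \<open>Signs are those of characteristic 2.\<close>

definition Har1 :: "('k::field \<Rightarrow> 'a \<Rightarrow> 'a) \<Rightarrow> ('k, 'a \<Rightarrow> 'a::comm_ring) vspace" where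
  "Har1 s = class_vs (\<lambda>c D a. s c (D a))
     {D. Vector_Spaces.linear s s D \<and> (\<forall>a b. D (a * b) = a * D b + D a * b)}"

definition Har2_cocycles :: "('k::field \<Rightarrow> 'a \<Rightarrow> 'a) \<Rightarrow> ('a \<Rightarrow> 'a \<Rightarrow> 'a::comm_ring) set" where
  "Har2_cocycles s = {\<beta>.
     (\<forall>a. Vector_Spaces.linear s s (\<beta> a)) \<and> (\<forall>b. Vector_Spaces.linear s s (\<lambda>a. \<beta> a b)) \<and>
     (\<forall>a b. \<beta> a b = \<beta> b a) \<and>
     (\<forall>a b c. a * \<beta> b c + \<beta> (a * b) c + \<beta> a (b * c) + \<beta> a b * c = 0)}"

definition Har2_coboundaries :: "('k::field \<Rightarrow> 'a \<Rightarrow> 'a) \<Rightarrow> ('a \<Rightarrow> 'a \<Rightarrow> 'a::comm_ring) set" where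
  "Har2_coboundaries s =
     {\<lambda>a b. a * \<omega> b + \<omega> (a * b) + \<omega> a * b | \<omega>. Vector_Spaces.linear s s \<omega>}"

definition Har2 :: "('k::field \<Rightarrow> 'a \<Rightarrow> 'a) \<Rightarrow> ('k, ('a \<Rightarrow> 'a \<Rightarrow> 'a::comm_ring) set) vspace" where
  "Har2 s = quotient (class_vs (\<lambda>c \<beta> a b. s c (\<beta> a b)) (Har2_cocycles s)) (Har2_coboundaries s)"

end

theory Submission
  imports Defs
begin

text \<open>
  In the basis \<open>e, h, f\<close> the current algebra \<open>S \<otimes> A\<close> is \<open>A\<^sup>3\<close> with the bracket of \<open>S\<close> extended
  \<open>A\<close>-bilinearly, and it is graded by \<open>deg e = 1\<close>, \<open>deg h = 0\<close>, \<open>deg f = -1\<close>. Its cochains are only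
  \<open>K\<close>-multilinear, so a cochain is a family of \<open>K\<close>-multilinear maps from copies of \<open>A\<close> to \<open>A\<close>, one for
  each choice of basis vectors, and the cocycle condition is a system of functional equations that
  splits by degree. Putting \<open>1\<close> for some of the arguments nearly solves it.

  In degree one, every derivation is the sum of an inner one, a multiple of each of the two outer
  derivations \<open>f \<mapsto> e\<close> and \<open>e \<mapsto> f\<close> of \<open>S\<close> (the squares of \<open>ad e\<close> and \<open>ad f\<close>), and a derivation \<open>\<delta>\<close> of
  \<open>A\<close> acting on the coefficients; \<open>derivation_h_part\<close> is the heart of this. Coefficients of the outer
  derivations and \<open>\<delta>\<close> are read off the values at \<open>f\<close>, \<open>e\<close> and \<open>h \<otimes> a\<close>.

  In degree two, the coefficient of \<open>e\<close> in \<open>\<phi>(f, h)\<close> and that of \<open>f\<close> in \<open>\<phi>(e, h)\<close> do not change under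
  coboundaries. If they are \<open>0\<close>, an explicit coboundary removes enough values with
  an argument in \<open>S \<otimes> 1\<close> for the functional equations to force \<open>\<phi>(x \<otimes> a, y \<otimes> b) = [x, y] \<otimes> \<beta>(a, b)\<close>
  with one symmetric Hochschild cocycle \<open>\<beta>\<close> (\<open>normal_form\<close>). The map \<open>\<beta>\<close> is given by a formula linear
  in \<open>\<phi>\<close> (\<open>harrison\<close>) which carries coboundaries to Hochschild coboundaries.

  Therefore \<open>H\<^sup>n(S \<otimes> A, S \<otimes> A)\<close> is \<open>A\<^sup>2 \<oplus> Har\<^sup>n(A, A)\<close> for \<open>n = 1, 2\<close>. The same statement for
  \<open>A = K\<close>, where \<open>Har\<^sup>n(K, K) = 0\<close>, says that \<open>H\<^sup>n(S, S)\<close> is \<open>K\<^sup>2\<close>, and \<open>K\<^sup>2 \<otimes> A\<close> is \<open>A\<^sup>2\<close>.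

  Three general facts connect this computation with the quotients of the statement: a quotient is
  the space of fibres of any surjection with the right kernel (\<open>fibres_vs_isom_quotient\<close>), isomorphic
  Lie algebras have isomorphic cohomology (\<open>cohomology_vs_isom\<close>), and \<open>V \<otimes> A\<close> is computed by
  coordinates on \<open>V\<close> (\<open>fibre_vs_isom_tensor\<close>).
\<close>

section \<open>Isomorphisms of vector spaces with explicit carriers\<close>

definition vs_isom where
  "vs_isom f V W \<longleftrightarrow> bij_betw f (carr V) (carr W) \<and>
     (\<forall>x\<in>carr V. \<forall>y\<in>carr V. f (add V x y) = add W (f x) (f y)) \<and>
     (\<forall>c. \<forall>x\<in>carr V. f (scl V c x) = scl W c (f x))"

lemma vs_iso_iff: "V \<cong>\<^sub>K W \<longleftrightarrow> (\<exists>f. vs_isom f V W)"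
  unfolding vs_iso_def vs_isom_def ..

definition vs_closed where
  "vs_closed V \<longleftrightarrow> (\<forall>x\<in>carr V. \<forall>y\<in>carr V. add V x y \<in> carr V) \<and> (\<forall>c. \<forall>x\<in>carr V. scl V c x \<in> carr V)"

lemma class_vs_simps [simp]:
  "carr (class_vs s U) = U" "add (class_vs s U) = (+)" "zro (class_vs s U) = 0"
  "scl (class_vs s U) = s"
  by (simp_all add: class_vs_def)

lemma direct_sum_simps [simp]:
  "carr (V \<oplus>\<^sub>K W) = carr V \<times> carr W"
  "add (V \<oplus>\<^sub>K W) x y = (add V (fst x) (fst y), add W (snd x) (snd y))"
  "scl (V \<oplus>\<^sub>K W) c x = (scl V c (fst x), scl W c (snd x))"
  by (simp_all add: direct_sum_def)

lemma vs_isom_trans: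
  assumes "vs_isom f V W" "vs_isom g W X"
  shows "vs_isom (g \<circ> f) V X"
  using assms unfolding vs_isom_def by (auto intro: bij_betw_trans dest: bij_betwE)

lemma vs_isom_direct_sum:
  assumes "vs_isom f V V'" "vs_isom g W W'"
  shows "vs_isom (map_prod f g) (V \<oplus>\<^sub>K W) (V' \<oplus>\<^sub>K W')"
  using assms unfolding vs_isom_def by (auto intro: bij_betw_map_prod)

text \<open>
  The inverse of \<open>f\<close> is linear because \<open>W\<close> is closed. Isomorphisms below are constructed in the
  direction from an explicit space \<open>W\<close> to a quotient, so two of them are compared through \<open>W\<close>.
\<close>
lemma vs_iso_common_source:
  assumes f: "vs_isom f W X" and g: "vs_isom g W Y" and W: "vs_closed W"
  shows "X \<cong>\<^sub>K Y"
proof -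
  let ?h = "g \<circ> inv_into (carr W) f"
  have bf: "bij_betw f (carr W) (carr X)" and bg: "bij_betw g (carr W) (carr Y)"
    using f g by (auto simp: vs_isom_def)
  have img: "\<exists>w\<in>carr W. x = f w" if "x \<in> carr X" for x
    using bf that by (auto simp: bij_betw_def)
  have h: "?h (f w) = g w" if "w \<in> carr W" for w
    using bf that by (simp add: bij_betw_def)
  have "vs_isom ?h X Y"
    unfolding vs_isom_def
  proof (intro conjI ballI allI)
    show "bij_betw ?h (carr X) (carr Y)"
      by (rule bij_betw_trans[OF bij_betw_inv_into[OF bf] bg])
  next
    fix x y assume "x \<in> carr X" "y \<in> carr X"
    then obtain v w where vw: "v \<in> carr W" "w \<in> carr W" "x = f v" "y = f w" using img by blast
    then have "add X x y = f (add W v w)" "add W v w \<in> carr W"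
      using f W by (auto simp: vs_isom_def vs_closed_def)
    then show "?h (add X x y) = add Y (?h x) (?h y)"
      using vw h g by (simp del: o_apply add: vs_isom_def)
  next
    fix c x assume "x \<in> carr X"
    then obtain w where w: "w \<in> carr W" "x = f w" using img by blast
    then have "scl X c x = f (scl W c w)" "scl W c w \<in> carr W"
      using f W by (auto simp: vs_isom_def vs_closed_def)
    then show "?h (scl X c x) = scl Y c (?h x)"
      using w h g by (simp del: o_apply add: vs_isom_def)
  qed
  then show ?thesis by (auto simp: vs_iso_iff)
qed

lemma vs_isoI: "vs_isom F V W \<Longrightarrow> V \<cong>\<^sub>K W"
  by (auto simp: vs_iso_iff)

lemma vs_isom_id: "vs_isom (\<lambda>x. x) V V"
  by (simp add: vs_isom_def bij_betw_def)

lemma vs_isom_direct_sum_trivial: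
  assumes "carr W = {w}" "vs_closed W"
  shows "vs_isom (\<lambda>v. (v, w)) V (V \<oplus>\<^sub>K W)"
  using assms by (auto simp: vs_isom_def vs_closed_def bij_betw_def inj_on_def)

section \<open>Quotients as fibres of linear maps\<close>

lemma quotient_simps [simp]:
  "carr (quotient V N) = coset V N ` carr V"
  "add (quotient V N) X Y = {add V x y | x y. x \<in> X \<and> y \<in> Y}"
  "zro (quotient V N) = N"
  "scl (quotient V N) c X = (\<Union>x\<in>X. coset V N (scl V c x))"
  by (simp_all add: quotient_def)

text \<open>
  The cosets of the kernel are the fibres; with this, a coset is determined by a value of \<open>q\<close>
  and choices of representatives disappear.
\<close>
lemma coset_eq_fibre:
  assumes s: "module s" and U: "module.subspace s U" and N: "N \<subseteq> U"
    and ker: "\<And>x y. x \<in> U \<Longrightarrow> y \<in> U \<Longrightarrow> q x = q y \<longleftrightarrow> x - y \<in> N"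
    and x: "x \<in> U"
  shows "coset (class_vs s U) N x = {y \<in> U. q y = q x}"
proof -
  interpret module s by (rule s)
  have "y \<in> U \<and> q y = q x" if "y = x + n" "n \<in> N" for y n
    using that x N ker[of y x] U by (auto simp: subspace_add)
  moreover have "\<exists>n. y = x + n \<and> n \<in> N" if "y \<in> U" "q y = q x" for y
    using that x ker[of y x] by (intro exI[of _ "y - x"]) auto
  ultimately show ?thesis by (auto simp: coset_def)
qed

text \<open>
  The first isomorphism theorem, read from the image to the quotient: \<open>w\<close> goes to its fibre.
  The target \<open>W\<close> may itself be a quotient, since only its operations enter.
\<close>
lemma fibres_vs_isom_quotient:
  assumes s: "module s" and U: "module.subspace s U" and N: "N \<subseteq> U"
    and surj: "q ` U = carr W"
    and q_add: "\<And>x y. x \<in> U \<Longrightarrow> y \<in> U \<Longrightarrow> q (x + y) = add W (q x) (q y)"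
    and q_scl: "\<And>c x. x \<in> U \<Longrightarrow> q (s c x) = scl W c (q x)"
    and ker: "\<And>x y. x \<in> U \<Longrightarrow> y \<in> U \<Longrightarrow> q x = q y \<longleftrightarrow> x - y \<in> N"
  shows "vs_isom (\<lambda>w. {x \<in> U. q x = w}) W (quotient (class_vs s U) N)"
proof -
  interpret module s by (rule s)
  let ?F = "\<lambda>w. {x \<in> U. q x = w}" and ?V = "class_vs s U"
  have cos: "coset ?V N x = ?F (q x)" if "x \<in> U" for x
    by (rule coset_eq_fibre[OF s U N ker that])
  have img: "\<exists>x\<in>U. w = q x" if "w \<in> carr W" for w using surj that by blast
  show ?thesis unfolding vs_isom_def
  proof (intro conjI ballI allI)
    show "bij_betw ?F (carr W) (carr (quotient ?V N))"
    proof (rule bij_betw_imageI)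
      show "inj_on ?F (carr W)"
        by (rule inj_onI) (use img in blast)
      show "?F ` carr W = carr (quotient ?V N)"
        by (simp add: surj[symmetric] image_image cos cong: image_cong)
    qed
  next
    fix v w assume "v \<in> carr W" "w \<in> carr W"
    then obtain x y where xy: "x \<in> U" "y \<in> U" "v = q x" "w = q y" using img by blast
    show "?F (add W v w) = add (quotient ?V N) (?F v) (?F w)"
    proof (rule set_eqI)
      fix z
      show "z \<in> ?F (add W v w) \<longleftrightarrow> z \<in> add (quotient ?V N) (?F v) (?F w)"
      proof
        assume z: "z \<in> ?F (add W v w)"
        then have "z \<in> U" "q z = q (x + y)" using xy q_add by auto
        then have "z - (x + y) \<in> N" "z - x \<in> U" "x + y \<in> U"
          using ker[of z "x + y"] U xy by (auto simp: subspace_diff subspace_add)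
        then have "q (z - x) = q y" using ker[of "z - x" y] xy by (simp add: algebra_simps)
        then show "z \<in> add (quotient ?V N) (?F v) (?F w)"
          using xy \<open>z - x \<in> U\<close> by (simp, rule_tac x=x in exI, rule_tac x="z - x" in exI) simp
      next
        assume "z \<in> add (quotient ?V N) (?F v) (?F w)"
        then show "z \<in> ?F (add W v w)" using q_add U by (auto simp: subspace_add)
      qed
    qed
  next
    fix c w assume "w \<in> carr W"
    then obtain x where x: "x \<in> U" "w = q x" using img by blast
    have "coset ?V N (s c y) = ?F (scl W c w)" if "y \<in> ?F w" for y
      using that cos[of "s c y"] q_scl U by (auto simp: subspace_scale)
    then show "?F (scl W c w) = scl (quotient ?V N) c (?F w)" using x by auto
  qed
qed

lemma coset_class_vs_eq_iff:
  assumes s: "module s" and N: "module.subspace s N"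
  shows "coset (class_vs s U) N x = coset (class_vs s U) N y \<longleftrightarrow> x - y \<in> N"
proof -
  interpret module s by (rule s)
  show ?thesis
  proof
    assume "coset (class_vs s U) N x = coset (class_vs s U) N y"
    moreover have "x \<in> coset (class_vs s U) N x"
      using N by (auto simp: coset_def subspace_0 intro!: exI[of _ 0])
    ultimately show "x - y \<in> N" by (auto simp: coset_def)
  next
    assume d: "x - y \<in> N"
    have "\<exists>m. x + n = y + m \<and> m \<in> N" if "n \<in> N" for n
      using that N d by (intro exI[of _ "(x - y) + n"]) (auto simp: subspace_add)
    moreover have "\<exists>m. y + n = x + m \<and> m \<in> N" if "n \<in> N" for n
      using that N d by (intro exI[of _ "n - (x - y)"]) (auto simp: subspace_diff)
    ultimately show "coset (class_vs s U) N x = coset (class_vs s U) N y"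
      unfolding coset_def by auto
  qed
qed

lemma add_coset_class_vs:
  assumes s: "module s" and N: "module.subspace s N"
  shows "add (quotient (class_vs s U) N) (coset (class_vs s U) N x) (coset (class_vs s U) N y)
     = coset (class_vs s U) N (x + y)"
proof -
  interpret module s by (rule s)
  have "\<exists>k. (x + n) + (y + m) = (x + y) + k \<and> k \<in> N" if "n \<in> N" "m \<in> N" for n m
    using that N by (intro exI[of _ "n + m"]) (auto simp: subspace_add)
  moreover have "\<exists>v w. (x + y) + n = v + w \<and> (\<exists>n. v = x + n \<and> n \<in> N) \<and> (\<exists>n. w = y + n \<and> n \<in> N)"
    if "n \<in> N" for n
    using that N by (intro exI[of _ x] exI[of _ "y + n"]) (auto simp: subspace_0 intro!: exI[of _ 0])
  ultimately show ?thesis by (fastforce simp: coset_def)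
qed

lemma scl_coset_class_vs:
  assumes s: "module s" and N: "module.subspace s N"
  shows "scl (quotient (class_vs s U) N) c (coset (class_vs s U) N x) = coset (class_vs s U) N (s c x)"
proof -
  interpret module s by (rule s)
  have "coset (class_vs s U) N (s c v) = coset (class_vs s U) N (s c x)"
    if "v \<in> coset (class_vs s U) N x" for v
  proof -
    have "v - x \<in> N" using that by (auto simp: coset_def)
    then have "s c (v - x) \<in> N" using N by (rule subspace_scale[rotated])
    then show ?thesis by (simp add: coset_class_vs_eq_iff[OF s N] scale_right_diff_distrib)
  qed
  moreover have "coset (class_vs s U) N x \<noteq> {}"
    using N by (auto simp: coset_def dest: subspace_0)
  ultimately show ?thesis by (simp add: SUP_eq_const del: class_vs_simps(1-3))
qed

lemma vs_closed_quotient_class_vs: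
  assumes s: "module s" and U: "module.subspace s U" and N: "module.subspace s N"
  shows "vs_closed (quotient (class_vs s U) N)"
proof -
  interpret module s by (rule s)
  show ?thesis
    using U add_coset_class_vs[OF s N, of U] scl_coset_class_vs[OF s N, of U]
    by (auto simp: vs_closed_def subspace_add subspace_scale simp del: quotient_simps(2,4))
qed

lemma vs_closed_direct_sum:
  "vs_closed V \<Longrightarrow> vs_closed W \<Longrightarrow> vs_closed (V \<oplus>\<^sub>K W)"
  by (auto simp: vs_closed_def)

text \<open>
  Transport along a bijection \<open>f\<close> of the ambient spaces. The ambient set \<open>P\<close> contains both the
  subspace and the relations, so that \<open>f\<close> is injective on whole cosets.
\<close>
lemma quotient_vs_isom_image:
  assumes inj: "inj_on f P" and N: "N \<subseteq> P" and U: "carr V \<subseteq> P"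
    and addP: "\<And>x y. x \<in> P \<Longrightarrow> y \<in> P \<Longrightarrow> add V x y \<in> P"
    and sclP: "\<And>c x. x \<in> P \<Longrightarrow> scl V c x \<in> P"
    and f_add: "\<And>x y. x \<in> P \<Longrightarrow> y \<in> P \<Longrightarrow> f (add V x y) = add V' (f x) (f y)"
    and f_scl: "\<And>c x. x \<in> P \<Longrightarrow> f (scl V c x) = scl V' c (f x)"
    and carr': "f ` carr V = carr V'" and N': "f ` N = N'"
  shows "vs_isom (image f) (quotient V N) (quotient V' N')"
proof -
  have cosP: "coset V N x \<subseteq> P" if "x \<in> P" for x
    using that N addP by (auto simp: coset_def)
  have f_cos: "f ` coset V N x = coset V' N' (f x)" if "x \<in> P" for x
  proof -
    have "f ` coset V N x = (\<lambda>n. f (add V x n)) ` N" by (auto simp: coset_def)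
    also have "\<dots> = (\<lambda>n. add V' (f x) (f n)) ` N"
      by (rule image_cong) (use that N f_add in auto)
    also have "\<dots> = coset V' N' (f x)" by (auto simp: coset_def N'[symmetric])
    finally show ?thesis .
  qed
  have carrP: "X \<subseteq> P" if "X \<in> carr (quotient V N)" for X
    using that cosP U by auto
  show ?thesis unfolding vs_isom_def
  proof (intro conjI ballI allI)
    show "bij_betw (image f) (carr (quotient V N)) (carr (quotient V' N'))"
    proof (rule bij_betw_imageI)
      show "inj_on (image f) (carr (quotient V N))"
        by (rule inj_on_subset[OF inj_on_image_Pow[OF inj]]) (use carrP in blast)
      have "(\<lambda>x. f ` coset V N x) ` carr V = (\<lambda>x. coset V' N' (f x)) ` carr V"
        by (rule image_cong) (use f_cos U in auto)
      then show "image f ` carr (quotient V N) = carr (quotient V' N')"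
        by (simp add: image_image carr'[symmetric])
    qed
  next
    fix X Y assume "X \<in> carr (quotient V N)" "Y \<in> carr (quotient V N)"
    then have XY: "X \<subseteq> P" "Y \<subseteq> P" using carrP by auto
    have "f ` add (quotient V N) X Y = (\<lambda>(x, y). f (add V x y)) ` (X \<times> Y)" by auto
    also have "\<dots> = (\<lambda>(x, y). add V' (f x) (f y)) ` (X \<times> Y)"
      by (rule image_cong) (use XY f_add in auto)
    also have "\<dots> = add (quotient V' N') (f ` X) (f ` Y)" by auto
    finally show "f ` add (quotient V N) X Y = add (quotient V' N') (f ` X) (f ` Y)" .
  next
    fix c X assume "X \<in> carr (quotient V N)"
    then have X: "X \<subseteq> P" using carrP by auto
    have "f ` scl (quotient V N) c X = (\<Union>x\<in>X. f ` coset V N (scl V c x))" by auto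
    also have "\<dots> = (\<Union>x\<in>X. coset V' N' (scl V' c (f x)))"
    proof (rule SUP_cong[OF refl])
      fix x assume "x \<in> X"
      then have "x \<in> P" using X by blast
      then show "f ` coset V N (scl V c x) = coset V' N' (scl V' c (f x))"
        by (simp only: f_cos sclP f_scl)
    qed
    also have "\<dots> = scl (quotient V' N') c (f ` X)" by auto
    finally show "f ` scl (quotient V N) c X = scl (quotient V' N') c (f ` X)" .
  qed
qed

section \<open>Cohomology of isomorphic Lie algebras\<close>

text \<open>
  Closure and the behaviour of zero are required of \<open>L\<close> only; \<open>L'\<close> inherits them along the bijection.
\<close>
locale lie_isom =
  fixes L :: "('k::field, 'v, 'm) lie_alg_scheme" and L' :: "('k, 'w, 'n) lie_alg_scheme"
    and \<theta> :: "'v \<Rightarrow> 'w"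
  assumes bij: "bij_betw \<theta> (carr L) (carr L')"
    and zro_closed: "zro L \<in> carr L"
    and add_closed: "\<And>x y. x \<in> carr L \<Longrightarrow> y \<in> carr L \<Longrightarrow> add L x y \<in> carr L"
    and scl_closed: "\<And>c x. x \<in> carr L \<Longrightarrow> scl L c x \<in> carr L"
    and brk_closed: "\<And>x y. x \<in> carr L \<Longrightarrow> y \<in> carr L \<Longrightarrow> brk L x y \<in> carr L"
    and add_zro: "add L (zro L) (zro L) = zro L" and scl_zro: "\<And>c. scl L c (zro L) = zro L"
    and hom_zro: "\<theta> (zro L) = zro L'"
    and hom_add: "\<And>x y. x \<in> carr L \<Longrightarrow> y \<in> carr L \<Longrightarrow> \<theta> (add L x y) = add L' (\<theta> x) (\<theta> y)"
    and hom_scl: "\<And>c x. x \<in> carr L \<Longrightarrow> \<theta> (scl L c x) = scl L' c (\<theta> x)"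
    and hom_brk: "\<And>x y. x \<in> carr L \<Longrightarrow> y \<in> carr L \<Longrightarrow> \<theta> (brk L x y) = brk L' (\<theta> x) (\<theta> y)"
begin

abbreviation (input) \<xi> where "\<xi> \<equiv> inv_into (carr L) \<theta>"

lemma inverse_apply [simp]: "x \<in> carr L \<Longrightarrow> \<xi> (\<theta> x) = x"
  using bij by (simp add: bij_betw_def)

lemma apply_inverse [simp]: "y \<in> carr L' \<Longrightarrow> \<theta> (\<xi> y) = y"
  using bij by (simp add: bij_betw_inv_into_right)

lemma apply_closed: "x \<in> carr L \<Longrightarrow> \<theta> x \<in> carr L'"
  using bij by (auto dest: bij_betwE)

lemma inverse_closed: "y \<in> carr L' \<Longrightarrow> \<xi> y \<in> carr L"
  using bij_betw_inv_into[OF bij] by (auto dest: bij_betwE)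

text \<open>
  The situation is symmetric, which gives surjectivity of the induced map on cochains for free.
\<close>
lemma lie_isom_inverse: "lie_isom L' L \<xi>"
proof
  have *: "\<exists>x\<in>carr L. y = \<theta> x" if "y \<in> carr L'" for y
    using apply_inverse[OF that] inverse_closed[OF that] by metis
  show "bij_betw \<xi> (carr L') (carr L)" by (rule bij_betw_inv_into[OF bij])
  show "zro L' \<in> carr L'" using apply_closed[OF zro_closed] by (simp add: hom_zro)
  show "add L' (zro L') (zro L') = zro L'" "scl L' c (zro L') = zro L'" for c
    using hom_add[OF zro_closed zro_closed] hom_scl[OF zro_closed, of c]
    by (simp_all add: hom_zro add_zro scl_zro)
  show "\<xi> (zro L') = zro L" using zro_closed hom_zro inverse_apply by metis
  fix x y assume "x \<in> carr L'" "y \<in> carr L'"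
  then obtain u v where uv: "u \<in> carr L" "v \<in> carr L" "x = \<theta> u" "y = \<theta> v" using * by metis
  then have eqs: "add L' x y = \<theta> (add L u v)" "brk L' x y = \<theta> (brk L u v)"
    by (simp_all add: hom_add hom_brk)
  show "add L' x y \<in> carr L'" "brk L' x y \<in> carr L'"
    "\<xi> (add L' x y) = add L (\<xi> x) (\<xi> y)" "\<xi> (brk L' x y) = brk L (\<xi> x) (\<xi> y)"
    unfolding eqs using uv by (simp_all add: apply_closed add_closed brk_closed)
next
  fix c x assume x: "x \<in> carr L'"
  then have eq: "scl L' c x = \<theta> (scl L c (\<xi> x))" by (simp add: hom_scl inverse_closed)
  show "scl L' c x \<in> carr L'" "\<xi> (scl L' c x) = scl L c (\<xi> x)"
    unfolding eq using x by (simp_all add: apply_closed scl_closed inverse_closed)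
qed

lemma map_args: "xs \<in> args L n \<Longrightarrow> map \<theta> xs \<in> args L' n"
  using apply_closed by (auto simp: args_def)

lemma map_inverse_args: "ys \<in> args L' n \<Longrightarrow> map \<xi> ys \<in> args L n"
  using inverse_closed by (auto simp: args_def)

lemma map_inverse_map: "xs \<in> args L n \<Longrightarrow> map \<xi> (map \<theta> xs) = xs"
  by (auto simp: args_def intro!: map_idI)

lemma map_map_inverse: "ys \<in> args L' n \<Longrightarrow> map \<theta> (map \<xi> ys) = ys"
  by (auto simp: args_def intro!: map_idI)

text \<open>
  An ambient space for cochains, coboundaries and differentials alike.
\<close>
definition valued_funs :: "nat \<Rightarrow> ('v list \<Rightarrow> 'v) set" where
  "valued_funs n = {\<phi>. (\<forall>xs\<in>args L n. \<phi> xs \<in> carr L) \<and> (\<forall>xs. xs \<notin> args L n \<longrightarrow> \<phi> xs = zro L)}"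

definition push :: "nat \<Rightarrow> ('v list \<Rightarrow> 'v) \<Rightarrow> 'w list \<Rightarrow> 'w" where
  "push n \<phi> ys = (if ys \<in> args L' n then \<theta> (\<phi> (map \<xi> ys)) else zro L')"

lemma push_map: "xs \<in> args L n \<Longrightarrow> push n \<phi> (map \<theta> xs) = \<theta> (\<phi> xs)"
  using map_args[of xs n] map_inverse_map[of xs n] by (simp add: push_def)

lemma inj_on_push: "inj_on (push n) (valued_funs n)"
proof (rule inj_onI, rule ext)
  fix \<phi> \<psi> xs assume *: "\<phi> \<in> valued_funs n" "\<psi> \<in> valued_funs n" "push n \<phi> = push n \<psi>"
  show "\<phi> xs = \<psi> xs"
  proof (cases "xs \<in> args L n")
    case True
    then have "\<theta> (\<phi> xs) = \<theta> (\<psi> xs)" using *(3) push_map[of xs n \<phi>] push_map[of xs n \<psi>] by simp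
    then show ?thesis using True * bij by (auto simp: valued_funs_def bij_betw_def inj_on_def)
  qed (use * in \<open>auto simp: valued_funs_def\<close>)
qed

lemma zro': "add L' (zro L') (zro L') = zro L'" "scl L' c (zro L') = zro L'"
  using lie_isom.add_zro[OF lie_isom_inverse] lie_isom.scl_zro[OF lie_isom_inverse] by auto

lemma push_add:
  assumes "\<phi> \<in> valued_funs n" "\<psi> \<in> valued_funs n"
  shows "push n (\<lambda>xs. add L (\<phi> xs) (\<psi> xs)) = (\<lambda>ys. add L' (push n \<phi> ys) (push n \<psi> ys))"
  using assms map_inverse_args by (auto simp: fun_eq_iff push_def valued_funs_def hom_add zro')

lemma push_scl:
  assumes "\<phi> \<in> valued_funs n"
  shows "push n (\<lambda>xs. scl L c (\<phi> xs)) = (\<lambda>ys. scl L' c (push n \<phi> ys))"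
  using assms map_inverse_args by (auto simp: fun_eq_iff push_def valued_funs_def hom_scl zro')

lemma push_zro: "push n (\<lambda>xs. zro L) = (\<lambda>ys. zro L')"
  by (auto simp: push_def hom_zro)

lemma args_update: "xs \<in> args L n \<Longrightarrow> x \<in> carr L \<Longrightarrow> xs[i := x] \<in> args L n"
  using set_update_subset_insert[of xs i x] by (auto simp: args_def)

lemma cochains_subset_valued_funs: "carr (cochains L n) \<subseteq> valued_funs n"
  by (auto simp: cochains_def valued_funs_def)

lemma push_cochain:
  assumes \<phi>: "\<phi> \<in> carr (cochains L n)"
  shows "push n \<phi> \<in> carr (cochains L' n)"
proof -
  have vals: "\<phi> xs \<in> carr L" if "xs \<in> args L n" for xs using \<phi> that by (auto simp: cochains_def)
  have lift: "\<exists>xs\<in>args L n. ys = map \<theta> xs" if "ys \<in> args L' n" for ys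
    using map_map_inverse[OF that] map_inverse_args[OF that] by metis
  have lift1: "\<exists>x\<in>carr L. y = \<theta> x" if "y \<in> carr L'" for y
    using apply_inverse[OF that] inverse_closed[OF that] by metis
  have push_update: "push n \<phi> ((map \<theta> xs)[i := \<theta> x]) = \<theta> (\<phi> (xs[i := x]))"
    if "xs \<in> args L n" "x \<in> carr L" for xs x i
    using push_map[OF args_update[OF that]] by (simp add: map_update)
  have "multilinear L' n (push n \<phi>)"
    unfolding multilinear_def
  proof (intro ballI allI impI conjI)
    fix ys i x y assume "ys \<in> args L' n" "i < n" "x \<in> carr L'" "y \<in> carr L'"
    then obtain xs u v where *: "xs \<in> args L n" "ys = map \<theta> xs" "u \<in> carr L" "v \<in> carr L"
      "x = \<theta> u" "y = \<theta> v" using lift lift1 by metis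
    have "\<phi> (xs[i := add L u v]) = add L (\<phi> (xs[i := u])) (\<phi> (xs[i := v]))"
      using \<phi> * \<open>i < n\<close> by (auto simp: cochains_def multilinear_def)
    then show "push n \<phi> (ys[i := add L' x y]) = add L' (push n \<phi> (ys[i := x])) (push n \<phi> (ys[i := y]))"
      using * by (simp add: push_update hom_add[symmetric] add_closed vals args_update)
  next
    fix ys i c x assume "ys \<in> args L' n" "i < n" "x \<in> carr L'"
    then obtain xs u where *: "xs \<in> args L n" "ys = map \<theta> xs" "u \<in> carr L" "x = \<theta> u"
      using lift lift1 by metis
    have "\<phi> (xs[i := scl L c u]) = scl L c (\<phi> (xs[i := u]))"
      using \<phi> * \<open>i < n\<close> by (auto simp: cochains_def multilinear_def)
    then show "push n \<phi> (ys[i := scl L' c x]) = scl L' c (push n \<phi> (ys[i := x]))"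
      using * by (simp add: push_update hom_scl[symmetric] scl_closed vals args_update)
  qed
  moreover have "alternating L' n (push n \<phi>)"
    unfolding alternating_def
  proof (intro ballI allI impI)
    fix ys i j assume "ys \<in> args L' n" and ij: "i < j \<and> j < n \<and> ys ! i = ys ! j"
    then obtain xs where *: "xs \<in> args L n" "ys = map \<theta> xs" using lift by metis
    then have "xs ! i = xs ! j" using ij bij
      by (auto simp: args_def bij_betw_def inj_on_def subset_iff)
    then have "\<phi> xs = zro L" using \<phi> * ij by (auto simp: cochains_def alternating_def)
    then show "push n \<phi> ys = zro L'" using * by (simp add: push_map hom_zro)
  qed
  ultimately show ?thesis
    using vals map_inverse_args by (auto simp: cochains_def push_def apply_closed)
qed

lemma push_push_inverse:
  assumes "\<psi> \<in> carr (cochains L' n)"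
  shows "push n (lie_isom.push L' L \<xi> n \<psi>) = \<psi>"
proof
  interpret inv: lie_isom L' L \<xi> by (rule lie_isom_inverse)
  fix ys
  show "push n (inv.push n \<psi>) ys = \<psi> ys"
  proof (cases "ys \<in> args L' n")
    case True
    then have "inv.push n \<psi> (map \<xi> ys) = \<xi> (\<psi> ys)" by (rule inv.push_map)
    then show ?thesis using True assms by (auto simp: push_def cochains_def)
  qed (use assms in \<open>auto simp: push_def cochains_def\<close>)
qed

lemma push_cochains: "push n ` carr (cochains L n) = carr (cochains L' n)"
proof
  show "carr (cochains L' n) \<subseteq> push n ` carr (cochains L n)"
    using lie_isom.push_cochain[OF lie_isom_inverse] push_push_inverse by (metis image_eqI subsetI)
qed (use push_cochain in auto)

lemma vsum_closed: "set vs \<subseteq> carr L \<Longrightarrow> vsum L vs \<in> carr L"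
  by (induction vs) (auto simp: vsum_def zro_closed add_closed)

lemma hom_vsum: "set vs \<subseteq> carr L \<Longrightarrow> \<theta> (vsum L vs) = vsum L' (map \<theta> vs)"
proof (induction vs)
  case (Cons v vs)
  then show ?case using vsum_closed[of vs] by (simp add: vsum_def hom_add)
qed (simp add: vsum_def hom_zro)

lemma nths_args:
  assumes "xs \<in> args L n" "card {i. i < n \<and> i \<in> I} = m"
  shows "nths xs I \<in> args L m"
  using assms set_nths_subset[of xs I] by (auto simp: args_def length_nths)

lemma nths_omit_args:
  assumes xs: "xs \<in> args L (Suc n)" and i: "i < Suc n"
  shows "nths xs (- {i}) \<in> args L n"
proof -
  have "{k. k < Suc n \<and> k \<in> - {i}} = {..<Suc n} - {i}" by auto
  then show ?thesis using nths_args[OF xs, of "- {i}" n] i by simp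
qed

lemma nths_omit2_args:
  assumes xs: "xs \<in> args L (Suc n)" and ij: "i < j" "j < Suc n"
  shows "brk L (xs ! i) (xs ! j) # nths xs (- {i, j}) \<in> args L n"
proof -
  have "{k. k < Suc n \<and> k \<in> - {i, j}} = {..<Suc n} - {i, j}" by auto
  moreover have "card ({..<Suc n} - {i, j}) = n - 1"
    using ij by (subst card_Diff_subset) auto
  ultimately have "nths xs (- {i, j}) \<in> args L (n - 1)"
    using nths_args[OF xs, of "- {i, j}" "n - 1"] by simp
  moreover have "xs ! i \<in> carr L" "xs ! j \<in> carr L" using xs ij by (auto simp: args_def)
  ultimately show ?thesis using ij by (auto simp: args_def brk_closed)
qed

text \<open>
  Every term of the differential is built from the operations of the Lie algebra, and omitting
  arguments commutes with applying \<open>\<theta>\<close> to all of them.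
\<close>
lemma CE_diff_push:
  assumes \<phi>: "\<phi> \<in> valued_funs n"
  shows "CE_diff L n \<phi> \<in> valued_funs (Suc n)" and "CE_diff L' n (push n \<phi>) = push (Suc n) (CE_diff L n \<phi>)"
proof -
  have vals: "\<phi> xs \<in> carr L" if "xs \<in> args L n" for xs using \<phi> that by (auto simp: valued_funs_def)
  have nth: "xs ! i \<in> carr L" "map \<theta> xs ! i = \<theta> (xs ! i)" if "xs \<in> args L (Suc n)" "i < Suc n" for xs i
    using that by (auto simp: args_def)
  let ?A = "\<lambda>xs. [scl L ((-1) ^ i) (brk L (xs ! i) (\<phi> (nths xs (- {i})))). i \<leftarrow> [0..<Suc n]]"
  let ?B = "\<lambda>xs. [scl L ((-1) ^ (i + j)) (\<phi> (brk L (xs ! i) (xs ! j) # nths xs (- {i, j}))).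
          j \<leftarrow> [0..<Suc n], i \<leftarrow> [0..<j]]"
  let ?A' = "\<lambda>xs. [scl L' ((-1) ^ i) (brk L' (xs ! i) (push n \<phi> (nths xs (- {i})))). i \<leftarrow> [0..<Suc n]]"
  let ?B' = "\<lambda>xs. [scl L' ((-1) ^ (i + j)) (push n \<phi> (brk L' (xs ! i) (xs ! j) # nths xs (- {i, j}))).
          j \<leftarrow> [0..<Suc n], i \<leftarrow> [0..<j]]"
  have AB: "set (?A xs) \<subseteq> carr L" "set (?B xs) \<subseteq> carr L" if "xs \<in> args L (Suc n)" for xs
    using that by (force intro!: scl_closed brk_closed vals nth nths_omit_args nths_omit2_args)+
  show 1: "CE_diff L n \<phi> \<in> valued_funs (Suc n)"
  proof -
    have "CE_diff L n \<phi> xs = add L (vsum L (?A xs)) (vsum L (?B xs))" if "xs \<in> args L (Suc n)" for xs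
      using that by (simp add: CE_diff_def del: upt_Suc)
    then have "CE_diff L n \<phi> xs \<in> carr L" if "xs \<in> args L (Suc n)" for xs
      using that by (simp only: add_closed vsum_closed AB)
    moreover have "CE_diff L n \<phi> xs = zro L" if "xs \<notin> args L (Suc n)" for xs
      using that by (simp add: CE_diff_def)
    ultimately show ?thesis by (simp only: valued_funs_def mem_Collect_eq) metis
  qed
  have face: "brk L' (map \<theta> xs ! i) (push n \<phi> (nths (map \<theta> xs) (- {i}))) = \<theta> (brk L (xs ! i) (\<phi> (nths xs (- {i}))))"
    "brk L (xs ! i) (\<phi> (nths xs (- {i}))) \<in> carr L"
    if "xs \<in> args L (Suc n)" "i < Suc n" for xs i
    using push_map[OF nths_omit_args[OF that]] vals[OF nths_omit_args[OF that]] nth[OF that]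
    by (simp_all add: nths_map hom_brk brk_closed)
  have A: "?A' (map \<theta> xs) = map \<theta> (?A xs)" if "xs \<in> args L (Suc n)" for xs
    unfolding map_map o_def
  proof (intro map_cong refl)
    fix i assume "i \<in> set [0..<Suc n]"
    then have "i < Suc n" by auto
    then show "scl L' ((-1) ^ i) (brk L' (map \<theta> xs ! i) (push n \<phi> (nths (map \<theta> xs) (- {i}))))
      = \<theta> (scl L ((-1) ^ i) (brk L (xs ! i) (\<phi> (nths xs (- {i})))))"
      using face[OF that] by (simp only: hom_scl)
  qed
  have face2: "push n \<phi> (brk L' (map \<theta> xs ! i) (map \<theta> xs ! j) # nths (map \<theta> xs) (- {i, j}))
      = \<theta> (\<phi> (brk L (xs ! i) (xs ! j) # nths xs (- {i, j})))"
    if "xs \<in> args L (Suc n)" "i < j" "j < Suc n" for xs i j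
    using push_map[OF nths_omit2_args[OF that]] that by (simp add: nth nths_map hom_brk del: nth_map)
  have B: "?B' (map \<theta> xs) = map \<theta> (?B xs)" if "xs \<in> args L (Suc n)" for xs
    unfolding map_concat map_map o_def
  proof (intro arg_cong[of _ _ concat] map_cong refl)
    fix j i assume "j \<in> set [0..<Suc n]" "i \<in> set [0..<j]"
    then have "i < j" "j < Suc n" by auto
    then show "scl L' ((-1) ^ (i + j)) (push n \<phi> (brk L' (map \<theta> xs ! i) (map \<theta> xs ! j) # nths (map \<theta> xs) (- {i, j})))
      = \<theta> (scl L ((-1) ^ (i + j)) (\<phi> (brk L (xs ! i) (xs ! j) # nths xs (- {i, j}))))"
      using face2[OF that] vals[OF nths_omit2_args[OF that]] by (simp only: hom_scl)
  qed
  show "CE_diff L' n (push n \<phi>) = push (Suc n) (CE_diff L n \<phi>)"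
  proof
    fix ys
    show "CE_diff L' n (push n \<phi>) ys = push (Suc n) (CE_diff L n \<phi>) ys"
    proof (cases "ys \<in> args L' (Suc n)")
      case True
      define xs where "xs = map \<xi> ys"
      have xs: "xs \<in> args L (Suc n)" "ys = map \<theta> xs"
        using map_inverse_args[OF True] map_map_inverse[OF True] by (simp_all add: xs_def)
      have "CE_diff L' n (push n \<phi>) ys = add L' (vsum L' (?A' ys)) (vsum L' (?B' ys))"
        using True by (simp add: CE_diff_def del: upt_Suc)
      also have "\<dots> = \<theta> (add L (vsum L (?A xs)) (vsum L (?B xs)))"
        unfolding xs(2) A[OF xs(1)] B[OF xs(1)]
        using AB[OF xs(1)] by (simp only: hom_add vsum_closed hom_vsum)
      also have "\<dots> = \<theta> (CE_diff L n \<phi> xs)" using xs(1) by (simp add: CE_diff_def del: upt_Suc)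
      also have "\<dots> = push (Suc n) (CE_diff L n \<phi>) ys" using push_map[OF xs(1)] xs(2) by simp
      finally show ?thesis .
    next
      case False
      then show ?thesis by (simp add: CE_diff_def push_def)
    qed
  qed
qed

lemma push_cocycles: "push n ` CE_cocycles L n = CE_cocycles L' n"
proof -
  have "push n \<phi> \<in> CE_cocycles L' n \<longleftrightarrow> \<phi> \<in> CE_cocycles L n" if \<phi>: "\<phi> \<in> carr (cochains L n)" for \<phi>
  proof -
    have v: "\<phi> \<in> valued_funs n" using \<phi> cochains_subset_valued_funs by blast
    have z: "(\<lambda>xs. zro L) \<in> valued_funs (Suc n)" by (simp add: valued_funs_def zro_closed)
    have "CE_diff L n \<phi> = (\<lambda>xs. zro L) \<longleftrightarrow> push (Suc n) (CE_diff L n \<phi>) = push (Suc n) (\<lambda>xs. zro L)"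
      using inj_on_push CE_diff_push(1)[OF v] z by (auto dest: inj_onD)
    then show ?thesis
      using \<phi> push_cochain[OF \<phi>] CE_diff_push(2)[OF v]
      by (auto simp: CE_cocycles_def fun_eq_iff push_zro)
  qed
  moreover have "CE_cocycles L n \<subseteq> carr (cochains L n)" "CE_cocycles L' n \<subseteq> push n ` carr (cochains L n)"
    unfolding push_cochains by (auto simp: CE_cocycles_def)
  ultimately show ?thesis by blast
qed

lemma push_coboundaries: "push n ` CE_coboundaries L n = CE_coboundaries L' n"
proof (cases n)
  case 0
  then show ?thesis by (simp add: CE_coboundaries_def push_zro)
next
  case (Suc m)
  have "push (Suc m) ` CE_diff L m ` carr (cochains L m) = CE_diff L' m ` push m ` carr (cochains L m)"
    unfolding image_image
    by (rule image_cong[OF refl]) (use CE_diff_push(2)[symmetric] cochains_subset_valued_funs in blast)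
  then show ?thesis by (simp add: Suc CE_coboundaries_def push_cochains)
qed

lemma coboundaries_subset_valued_funs: "CE_coboundaries L n \<subseteq> valued_funs n"
proof (cases n)
  case 0
  then show ?thesis by (simp add: CE_coboundaries_def valued_funs_def zro_closed)
next
  case (Suc m)
  then show ?thesis
    using CE_diff_push(1) cochains_subset_valued_funs by (auto simp: CE_coboundaries_def)
qed

theorem cohomology_vs_isom: "vs_isom (image (push n)) (CE_cohomology L n) (CE_cohomology L' n)"
  unfolding CE_cohomology_def
proof (rule quotient_vs_isom_image[where P = "valued_funs n"])
  show "inj_on (push n) (valued_funs n)" by (rule inj_on_push)
  show "CE_coboundaries L n \<subseteq> valued_funs n" by (rule coboundaries_subset_valued_funs)
  show "carr (cochains L n\<lparr>carr := CE_cocycles L n\<rparr>) \<subseteq> valued_funs n"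
    using cochains_subset_valued_funs by (auto simp: CE_cocycles_def)
  show "push n ` carr (cochains L n\<lparr>carr := CE_cocycles L n\<rparr>) = carr (cochains L' n\<lparr>carr := CE_cocycles L' n\<rparr>)"
    by (simp add: push_cocycles)
  show "push n ` CE_coboundaries L n = CE_coboundaries L' n" by (rule push_coboundaries)
qed (auto simp: cochains_def push_add push_scl, auto simp: valued_funs_def add_closed scl_closed add_zro scl_zro)

end

section \<open>Tensor products in coordinates\<close>

lemma lookup_free_scale [simp]:
  "Poly_Mapping.lookup (free_scale c p) k = c * Poly_Mapping.lookup p k"
  by (simp add: Poly_Mapping.map.rep_eq when_def)

lemma module_free_scale: "module (free_scale :: 'k::field \<Rightarrow> ('b \<Rightarrow>\<^sub>0 'k) \<Rightarrow> ('b \<Rightarrow>\<^sub>0 'k))"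
  by standard (auto intro!: poly_mapping_eqI simp: lookup_add algebra_simps)

lemma free_scale_single [simp]: "free_scale c (Poly_Mapping.single k d) = Poly_Mapping.single k (c * d)"
  by (rule poly_mapping_eqI) (simp add: lookup_single when_def)

lemma keys_free_scale_subset: "Poly_Mapping.keys (free_scale c p) \<subseteq> Poly_Mapping.keys p"
  by (auto simp: in_keys_iff)

lemma subspace_free_vs: "module.subspace free_scale {p :: 'b \<Rightarrow>\<^sub>0 'k::field. Poly_Mapping.keys p \<subseteq> B}"
proof -
  interpret module "free_scale :: 'k \<Rightarrow> ('b \<Rightarrow>\<^sub>0 'k) \<Rightarrow> _" by (rule module_free_scale)
  show ?thesis
    using subset_trans[OF keys_free_scale_subset]
    by (intro subspaceI) (auto dest!: subsetD[OF keys_add])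
qed

text \<open>
  The data say that \<open>V\<close> has a finite basis \<open>g (e i)\<close> with coordinates \<open>\<kappa> i\<close>, and that the bilinear map
  \<open>m\<close> makes the target a direct sum of copies of \<open>A\<close> indexed by the basis, with projections \<open>\<pi> i\<close>.
\<close>
locale tensor_coordinates = S: module s + A: module sA + T: module sT
  for s :: "'k::field \<Rightarrow> 'w::ab_group_add \<Rightarrow> 'w" and sA :: "'k \<Rightarrow> 'a::ab_group_add \<Rightarrow> 'a"
    and sT :: "'k \<Rightarrow> 't::ab_group_add \<Rightarrow> 't" +
  fixes V :: "('k, 'v, 'm) vspace_scheme" and g :: "'w \<Rightarrow> 'v" and m :: "'w \<Rightarrow> 'a \<Rightarrow> 't"
    and I :: "'i set" and e :: "'i \<Rightarrow> 'w" and \<kappa> :: "'i \<Rightarrow> 'w \<Rightarrow> 'k" and \<pi> :: "'i \<Rightarrow> 't \<Rightarrow> 'a"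
  assumes g_isom: "vs_isom g (class_vs s UNIV) V"
    and fin: "finite I"
    and expand: "\<And>u. u = (\<Sum>i\<in>I. s (\<kappa> i u) (e i))"
    and m_add_left: "\<And>u v a. m (u + v) a = m u a + m v a"
    and m_add_right: "\<And>u a b. m u (a + b) = m u a + m u b"
    and m_scale_left: "\<And>c u a. m (s c u) a = sT c (m u a)"
    and m_scale_right: "\<And>c u a. m u (sA c a) = sT c (m u a)"
    and coord_add: "\<And>i x y. i \<in> I \<Longrightarrow> \<pi> i (x + y) = \<pi> i x + \<pi> i y"
    and coord_scale: "\<And>i c x. i \<in> I \<Longrightarrow> \<pi> i (sT c x) = sA c (\<pi> i x)"
    and coord_m: "\<And>i u a. i \<in> I \<Longrightarrow> \<pi> i (m u a) = sA (\<kappa> i u) a"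
    and expand_target: "\<And>x. x = (\<Sum>i\<in>I. m (e i) (\<pi> i x))"
begin

lemma g_bij: "bij_betw g UNIV (carr V)" and g_add: "g (u + v) = add V (g u) (g v)"
  and g_scale: "g (s c u) = scl V c (g u)"
  using g_isom by (simp_all add: vs_isom_def)

lemma g_in [simp]: "g u \<in> carr V" using g_bij by (auto dest: bij_betwE)

lemma inv_g [simp]: "inv g (g u) = u" using g_bij by (simp add: bij_betw_def)

lemma carr_V: "carr V = range g" using g_bij by (simp add: bij_betw_def)

abbreviation "free \<equiv> {p :: 'v \<times> 'a \<Rightarrow>\<^sub>0 'k. Poly_Mapping.keys p \<subseteq> carr V \<times> UNIV}"
abbreviation "rels \<equiv> tensor_rels V (class_vs sA UNIV)"

sublocale F: module "free_scale :: 'k \<Rightarrow> ('v \<times> 'a \<Rightarrow>\<^sub>0 'k) \<Rightarrow> _"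
  by (rule module_free_scale)

text \<open>
  The linear extension of \<open>m\<close> to the free vector space on \<open>V \<times> A\<close>.
\<close>
definition contract :: "('v \<times> 'a \<Rightarrow>\<^sub>0 'k) \<Rightarrow> 't" where
  "contract p = (\<Sum>k\<in>Poly_Mapping.keys p. sT (Poly_Mapping.lookup p k) (m (inv g (fst k)) (snd k)))"

lemma contract_single: "contract (Poly_Mapping.single (g u, a) c) = sT c (m u a)"
  by (simp add: contract_def)

lemma contract_add: "contract (p + q) = contract p + contract q"
  unfolding contract_def by (rule setsum_keys_plus_distrib) (simp_all add: T.scale_left_distrib)

lemma contract_scale: "contract (free_scale c p) = sT c (contract p)"
proof -
  have "contract (free_scale c p) = (\<Sum>k\<in>Poly_Mapping.keys p.
      sT (c * Poly_Mapping.lookup p k) (m (inv g (fst k)) (snd k)))"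
    unfolding contract_def
    by (rule sum.mono_neutral_cong_left) (use keys_free_scale_subset in \<open>auto simp: in_keys_iff\<close>)
  then show ?thesis by (simp add: contract_def T.scale_sum_right)
qed

lemma contract_hom: "module_hom free_scale sT contract"
  by unfold_locales (simp_all add: contract_add contract_scale)

lemmas contract_diff = module_hom.diff[OF contract_hom]
  and contract_sum = module_hom.sum[OF contract_hom]
  and contract_0 = module_hom.zero[OF contract_hom]

lemma subspace_rels: "F.subspace rels"
  by (simp add: tensor_rels_def)

lemma rels_contract:
  assumes "p \<in> rels"
  shows "contract p = 0"
proof -
  have "contract p = 0" if "p \<in> tensor_gens V (class_vs sA UNIV)" for p
    using that by (auto simp: tensor_gens_def carr_V contract_diff contract_single m_add_left m_add_right
        m_scale_left m_scale_right simp flip: g_add g_scale)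
  moreover have "F.subspace {p. contract p = 0}"
    by (rule F.subspaceI) (simp_all add: contract_0 contract_add contract_scale)
  ultimately have "rels \<subseteq> {p. contract p = 0}"
    unfolding tensor_rels_def by (intro F.span_minimal) auto
  then show ?thesis using assms by auto
qed

lemma rels_subset: "rels \<subseteq> free"
  unfolding tensor_rels_def
proof (rule F.span_minimal[OF _ subspace_free_vs])
  have single: "Poly_Mapping.single (v, a) c \<in> free" if "v \<in> carr V" for v a c
    using that by simp
  have add: "add V x y \<in> carr V" and scl: "scl V c x \<in> carr V" if "x \<in> carr V" "y \<in> carr V" for c x y
    using that by (auto simp: carr_V simp flip: g_add g_scale)
  show "tensor_gens V (class_vs sA UNIV) \<subseteq> free"
  proof
    fix p assume "p \<in> tensor_gens V (class_vs sA UNIV)"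
    then show "p \<in> free"
      unfolding tensor_gens_def class_vs_simps
      by (elim UnE CollectE exE conjE)
        (simp_all only:, (intro F.subspace_diff[OF subspace_free_vs] single add scl; assumption)+)
  qed
qed

lemma rel_intros:
  "Poly_Mapping.single (g (u + v), a) 1 - Poly_Mapping.single (g u, a) 1 - Poly_Mapping.single (g v, a) 1 \<in> rels"
  "Poly_Mapping.single (g u, a + b) 1 - Poly_Mapping.single (g u, a) 1 - Poly_Mapping.single (g u, b) 1 \<in> rels"
  "Poly_Mapping.single (g (s c u), a) 1 - Poly_Mapping.single (g u, a) c \<in> rels"
  "Poly_Mapping.single (g u, sA c a) 1 - Poly_Mapping.single (g u, a) c \<in> rels"
  unfolding tensor_rels_def g_add g_scale
  by (rule F.span_base, force simp: tensor_gens_def)+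

text \<open>
  A preimage of \<open>x\<close> under contraction, supported on the basis; it is additive only modulo the
  tensor relations.
\<close>
definition representative :: "'t \<Rightarrow> ('v \<times> 'a \<Rightarrow>\<^sub>0 'k)" where
  "representative x = (\<Sum>i\<in>I. Poly_Mapping.single (g (e i), \<pi> i x) 1)"

lemma representative_free: "representative x \<in> free"
  unfolding representative_def by (rule F.subspace_sum[OF subspace_free_vs]) simp

lemma contract_representative: "contract (representative x) = x"
  using expand_target[of x] by (simp add: representative_def contract_sum contract_single)

lemma single_scale_rel: "Poly_Mapping.single (g (s c u), a) 1 - Poly_Mapping.single (g u, sA c a) 1 \<in> rels"
  using F.subspace_diff[OF subspace_rels rel_intros(3)[where c=c and u=u and a=a] rel_intros(4)[where c=c and u=u and a=a]] by simp

lemma single_sum_rel: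
  assumes "finite J"
  shows "Poly_Mapping.single (g (\<Sum>i\<in>J. u i), a) 1 - (\<Sum>i\<in>J. Poly_Mapping.single (g (u i), a) 1) \<in> rels"
  using assms
proof (induction J)
  case empty
  then show ?case using rel_intros(3)[where c=0 and u=0 and a=a] by simp
next
  case (insert j J)
  from F.subspace_add[OF subspace_rels rel_intros(1)[where u="u j" and v="\<Sum>i\<in>J. u i" and a=a] insert.IH]
  show ?case using insert.hyps by (simp add: algebra_simps)
qed

text \<open>
  Move the scalar into \<open>A\<close>, expand the vector in the basis, and move the coordinates into \<open>A\<close> as
  well: any pure tensor becomes its representative.
\<close>
lemma single_representative_rel: "Poly_Mapping.single (g u, a) c - representative (sT c (m u a)) \<in> rels"
proof -
  let ?b = "sA c a"
  have 1: "Poly_Mapping.single (g u, a) c - Poly_Mapping.single (g u, ?b) 1 \<in> rels"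
    using F.subspace_neg[OF subspace_rels rel_intros(4)[where c=c and u=u and a=a]] by simp
  have 2: "Poly_Mapping.single (g u, ?b) 1
      - (\<Sum>i\<in>I. Poly_Mapping.single (g (s (\<kappa> i u) (e i)), ?b) 1) \<in> rels"
    using single_sum_rel[OF fin, of "\<lambda>i. s (\<kappa> i u) (e i)" ?b] by (simp flip: expand)
  have 3: "(\<Sum>i\<in>I. Poly_Mapping.single (g (s (\<kappa> i u) (e i)), ?b) 1
      - Poly_Mapping.single (g (e i), sA (\<kappa> i u) ?b) 1) \<in> rels"
    by (rule F.subspace_sum[OF subspace_rels single_scale_rel])
  have 4: "representative (sT c (m u a)) = (\<Sum>i\<in>I. Poly_Mapping.single (g (e i), sA (\<kappa> i u) ?b) 1)"
    unfolding representative_def by (rule sum.cong) (simp_all add: coord_scale coord_m mult.commute)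
  show ?thesis
    using F.subspace_add[OF subspace_rels F.subspace_add[OF subspace_rels 1 2] 3]
    by (simp add: 4 sum_subtractf)
qed

lemma representative_add_rel: "representative (x + y) - (representative x + representative y) \<in> rels"
proof -
  have "representative (x + y) - (representative x + representative y) = (\<Sum>i\<in>I. Poly_Mapping.single (g (e i), \<pi> i x + \<pi> i y) 1
    - Poly_Mapping.single (g (e i), \<pi> i x) 1 - Poly_Mapping.single (g (e i), \<pi> i y) 1)"
    by (simp add: representative_def coord_add sum_subtractf)
  also have "\<dots> \<in> rels" by (rule F.subspace_sum[OF subspace_rels rel_intros(2)])
  finally show ?thesis .
qed

text \<open>
  By induction on the support. This is the reason why contraction has no kernel beyond the
  tensor relations.
\<close>
lemma representative_contract_rel:
  assumes "p \<in> free"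
  shows "p - representative (contract p) \<in> rels"
  using assms
proof (induction p rule: Poly_Mapping.update_induct)
  case const
  show ?case using F.subspace_neg[OF subspace_rels F.subspace_neg[OF subspace_rels representative_add_rel[of 0 0]]] by (simp add: contract_0)
next
  case (update p k c)
  have eq: "Poly_Mapping.update k c p = Poly_Mapping.single k c + p"
    using update.hyps by (intro poly_mapping_eqI) (auto simp: lookup_add lookup_update lookup_single in_keys_iff when_def)
  have "Poly_Mapping.keys (Poly_Mapping.update k c p) = insert k (Poly_Mapping.keys p)"
    using update.hyps by (auto simp: in_keys_iff lookup_update split: if_splits)
  then have "k \<in> carr V \<times> UNIV" "p \<in> free" using update.prems by auto
  then obtain u a where k: "k = (g u, a)" and IH: "p - representative (contract p) \<in> rels"
    using update.IH by (auto simp: carr_V)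
  let ?x = "sT c (m u a)"
  have "Poly_Mapping.single k c - representative ?x + (p - representative (contract p))
      - (representative (?x + contract p) - (representative ?x + representative (contract p))) \<in> rels"
    unfolding k by (intro F.subspace_diff[OF subspace_rels] F.subspace_add[OF subspace_rels]
        single_representative_rel representative_add_rel IH)
  moreover have "contract (Poly_Mapping.update k c p) = ?x + contract p"
    by (simp only: eq contract_add) (simp only: k contract_single)
  ultimately show ?case by (simp add: eq algebra_simps)
qed

lemma contract_eq_iff:
  assumes "p \<in> free" "q \<in> free"
  shows "contract p = contract q \<longleftrightarrow> p - q \<in> rels"
proof
  assume "contract p = contract q"
  then show "p - q \<in> rels"
    using F.subspace_diff[OF subspace_rels representative_contract_rel[OF assms(1)] representative_contract_rel[OF assms(2)]]
    by simp
qed (use rels_contract[of "p - q"] in \<open>simp add: contract_diff\<close>)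

theorem fibre_vs_isom_tensor:
  "vs_isom (\<lambda>x. {p \<in> free. contract p = x}) (class_vs sT UNIV) (V \<otimes>\<^sub>K class_vs sA UNIV)"
  unfolding tensor_def free_vs_def class_vs_simps
proof (rule fibres_vs_isom_quotient)
  show "contract ` free = carr (class_vs sT UNIV)"
    using representative_free contract_representative by (auto simp del: mem_Collect_eq intro!: rev_image_eqI)
qed (simp_all add: module_free_scale subspace_free_vs rels_subset contract_add contract_scale contract_eq_iff)

lemma coset_rels:
  assumes "p \<in> free"
  shows "coset (free_vs (carr V \<times> UNIV)) rels p = {q \<in> free. contract q = contract p}"
  unfolding free_vs_def
  by (rule coset_eq_fibre[OF module_free_scale subspace_free_vs rels_subset contract_eq_iff assms])

end

section \<open>Functional equations in characteristic 2\<close>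

locale char2_algebra = vector_space s
  for s :: "'k::field \<Rightarrow> 'a \<Rightarrow> 'a::{comm_ring, comm_monoid_mult}" +
  assumes char2: "CHAR('k) = 2"
    and scale_mult_left: "\<And>c a b. s c (a * b) = s c a * b"
begin

lemma scale_mult_right: "s c (a * b) = a * s c b"
  using scale_mult_left[of c b a] by (simp add: mult.commute)

lemma add_self [simp]: "x + x = (0::'a)"
proof -
  have "1 + 1 = (0::'k)" using of_nat_CHAR[where ?'a = 'k] by (simp add: char2)
  then have "s 1 x + s 1 x = s 0 x" by (metis scale_left_distrib)
  then show ?thesis by simp
qed

lemma add_self_left [simp]: "x + (x + y) = (y::'a)"
  unfolding add.assoc[symmetric] by simp

lemma minus_eq [simp]: "- x = (x::'a)" "x - y = x + (y::'a)"
proof -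
  show neg: "- x = x" for x :: 'a by (rule minus_unique) (rule add_self)
  show "x - y = x + y" using diff_conv_add_uminus[of x y] unfolding neg .
qed

text \<open>
  In characteristic 2 an equation is the vanishing of a sum, so functional equations can be
  solved for one term by moving all others across.
\<close>
lemma sum_zeroD:
  assumes "x + y = (0::'a)"
  shows "x = y"
proof -
  have "x + (x + y) = x" unfolding assms by (rule add_0_right)
  then show ?thesis unfolding add_self_left by (rule sym)
qed

text \<open>
  \<open>X\<close> stands for the component \<open>f \<otimes> a, f \<otimes> b \<mapsto> e\<close>. The first equation with \<open>c = 1\<close> expresses \<open>X\<close> by
  \<open>X(a, 1)\<close>, the second makes \<open>X(a, 1)\<close> linear over \<open>A\<close>, and \<open>X(1, 1) = 0\<close>.
\<close>
lemma degree3_vanishes: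
  assumes i: "\<And>a b c. a * X b c + b * X a c + c * X a b = (0::'a)"
    and ii: "\<And>a b c. c * X a b + X (a * c) b + X (b * c) a = 0"
    and alt: "\<And>a. X a a = 0"
  shows "X a b = 0"
proof -
  have X: "X a b = a * X b 1 + b * X a 1" for a b
    by (rule sum_zeroD) (use i[of a b 1] in \<open>simp add: ac_simps\<close>)
  have "X (a * c) 1 = a * X c 1" for a c
    by (rule sum_zeroD) (use ii[of c a 1] X[of c a] in \<open>simp add: ac_simps\<close>)
  from this[of _ 1] have "X a 1 = 0" for a by (simp add: alt)
  with X show ?thesis by simp
qed

text \<open>
  \<open>N\<close> and \<open>M\<close> stand for \<open>f, h \<mapsto> e\<close> and \<open>f, f \<mapsto> h\<close>. The second equation at \<open>1\<close> makes \<open>N\<close> symmetric,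
  the first makes it \<open>A\<close>-linear in its second argument; both vanish since \<open>N(1, 1) = 0\<close>.
  Without the normalisation the outer cocycle \<open>f, h \<mapsto> e\<close> survives.
\<close>
lemma degree2_vanishes:
  assumes i: "\<And>a b c. a * M b c + N c (a * b) + N b (a * c) = (0::'a)"
    and ii: "\<And>a b c. b * N a c + c * N a b + N (a * b) c + N (a * c) b = 0"
    and N1: "\<And>b. N 1 b = 0"
  shows "N a b = 0" and "M a b = 0"
proof -
  have sym: "N b c = N c b" for b c
    by (rule sum_zeroD) (use ii[of b 1 c] N1 in \<open>simp\<close>)
  have N: "N b a = a * M b 1" for a b
    by (rule sum_zeroD) (use i[of a b 1] N1 in \<open>simp add: ac_simps\<close>)
  have "M 1 1 = 0" using N[of 1 1] N1 by simp
  then have "M a 1 = 0" for a using sym[of a 1] N[of 1 a] N[of a 1] N1 by simp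
  then have N0: "N a b = 0" for a b using N by simp
  show "N a b = 0" "M a b = 0" using N0 i[of 1 a b] by simp_all
qed

text \<open>
  \<open>E, F, G, H\<close> stand for \<open>e, f \<mapsto> e\<close>, \<open>f, f \<mapsto> f\<close>, \<open>f, h \<mapsto> h\<close> and \<open>h, h \<mapsto> e\<close>. After normalisation all of
  them are expressed by the single map \<open>g(b) = H(b, 1)\<close>, and equation \<open>A\<close> at \<open>a = c = 1\<close> kills \<open>g\<close>.
\<close>
lemma degree1_vanishes:
  assumes A: "\<And>a b c. a * G c b + b * E a c + E (a * b) c + H (a * c) b + E a (b * c) = (0::'a)"
    and C: "\<And>a b c. a * E c b + b * E c a + c * F a b + G b (a * c) + G a (b * c) = 0"
    and D: "\<And>a b c. a * H b c + G (a * b) c + G (a * c) b = 0"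
    and I: "\<And>a b c. a * H b c + b * H a c + c * H a b = 0"
    and G1: "\<And>a. G a 1 = 0" and E1: "\<And>a. E a 1 = 0"
  shows "E a b = 0" "F a b = 0" "G a b = 0" "H a b = 0"
proof -
  define g where "g b = H b 1" for b
  have G: "G a b = a * g b" for a b
    by (rule sum_zeroD) (use D[of a b 1] in \<open>simp add: G1 g_def ac_simps\<close>)
  have H: "H a b = a * g b + b * g a" for a b
    by (rule sum_zeroD) (use I[of a b 1] in \<open>simp add: g_def ac_simps\<close>)
  have E: "E a b = b * g a" for a b
    by (rule sum_zeroD) (use A[of a 1 b] in \<open>simp add: G H E1 algebra_simps\<close>)
  have g1: "g 1 = 0" using G[of 1 1] G1 by simp
  have g0: "g b = 0" for b
    using A[of 1 1 b] by (simp add: G H E g1 algebra_simps)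
  have F0: "F a b = 0" using C[of a 1 b] by (simp add: G E g0)
  show "E a b = 0" "F a b = 0" "G a b = 0" "H a b = 0" by (simp_all add: E F0 G H g0)
qed

text \<open>
  \<open>P, Q, R, T\<close> stand for \<open>e, h \<mapsto> e\<close>, \<open>f, h \<mapsto> f\<close>, \<open>e, f \<mapsto> h\<close> and \<open>h, h \<mapsto> h\<close>. The equations \<open>III\<close> and \<open>III'\<close>
  express \<open>P\<close> and \<open>Q\<close> by \<open>R\<close> and its transpose, up to maps \<open>p\<close> and \<open>q\<close> of the product of the arguments
  which the other equations kill. After that \<open>T\<close> measures the asymmetry of \<open>R\<close>, and adding \<open>I\<close>,
  \<open>II\<close> and \<open>III\<close> leaves \<open>a T(b, c) = 0\<close>. Then \<open>II\<close> is the Hochschild cocycle identity.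
\<close>
lemma degree0_symmetric:
  assumes I: "\<And>a b c. a * T b c + b * P a c + c * P a b + P (a * b) c + P (a * c) b = (0::'a)"
    and I': "\<And>a b c. a * T b c + b * Q a c + c * Q a b + Q (a * b) c + Q (a * c) b = 0"
    and II: "\<And>a b c. a * Q c b + c * P a b + R (a * b) c + R a (b * c) + T (a * c) b = 0"
    and III: "\<And>a b c. a * R b c + b * R a c + P b (a * c) + P a (b * c) = 0"
    and III': "\<And>a b c. a * R c b + b * R c a + Q b (a * c) + Q a (b * c) = 0"
    and Tsym: "\<And>a b. T a b = T b a"
    and R1: "\<And>c. R 1 c = 0" and R1': "\<And>c. R c 1 = 0" and P1: "P 1 1 = 0"
  shows "P a b = R a b" "Q a b = R a b" "R a b = R b a" "T a b = 0"
    and "a * R b c + R (a * b) c + R a (b * c) + R a b * c = 0"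
proof -
  define p q where "p b = P 1 b" and "q b = Q 1 b" for b
  have P: "P a c = R a c + p (a * c)" for a c
    by (rule sum_zeroD) (use III[of a 1 c] in \<open>simp add: R1 R1' p_def ac_simps\<close>)
  have Q: "Q a c = R c a + q (a * c)" for a c
    by (rule sum_zeroD) (use III'[of a c 1] in \<open>simp add: R1 R1' q_def ac_simps\<close>)
  have p1: "p 1 = 0" by (simp add: p_def P1)
  have T1: "T b 1 = p b" for b
    by (rule sum_zeroD) (use I[of 1 b 1] in \<open>simp add: P R1 R1' p1 ac_simps\<close>)
  have q0: "q b = 0" for b
    using II[of 1 1 b] T1[of b] by (simp add: P Q R1 R1' Tsym[of 1 b] ac_simps)
  have p0: "p b = 0" for b
    using I'[of 1 b 1] T1[of b] by (simp add: Q q0 R1 R1' ac_simps)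
  have PR: "P a b = R a b" and QR: "Q a b = R b a" for a b by (simp_all add: P Q p0 q0)
  have T: "T b c = R b c + R c b" for b c
    by (rule sum_zeroD) (use I[of 1 b c] in \<open>simp add: PR R1 ac_simps\<close>)
  have "a * T b c = 0" for a b c
  proof -
    \<comment> \<open>The right-hand side is \<open>II + I + III\<close>.\<close>
    have "a * T b c = (a * Q c b + c * P a b + R (a * b) c + R a (b * c) + T (a * c) b)
      + (a * T b c + b * P a c + c * P a b + P (a * b) c + P (a * c) b)
      + (a * R b c + b * R a c + P b (a * c) + P a (b * c))"
      by (simp add: PR QR T algebra_simps)
    then show ?thesis by (simp only: I II III) simp
  qed
  from this[of 1] have T0: "T a b = 0" for a b by simp
  have sym: "R a b = R b a" for a b by (rule sum_zeroD) (use T[of a b] T0 in \<open>simp\<close>)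
  show "P a b = R a b" "Q a b = R a b" "R a b = R b a" "T a b = 0"
    using PR QR sym T0 by simp_all
  show "a * R b c + R (a * b) c + R a (b * c) + R a b * c = 0"
    using II[of a c b] by (simp add: QR PR T0 sym[of c b] ac_simps)
qed

end

section \<open>The bracket of S over a commutative algebra\<close>

definition scale3 :: "('k \<Rightarrow> 'a \<Rightarrow> 'a) \<Rightarrow> 'k \<Rightarrow> 'a \<times> 'a \<times> 'a \<Rightarrow> 'a \<times> 'a \<times> 'a" where
  "scale3 s c x = (s c (fst x), s c (fst (snd x)), s c (snd (snd x)))"

definition bracket3 :: "'a \<times> 'a \<times> 'a \<Rightarrow> 'a \<times> 'a \<times> 'a \<Rightarrow> 'a \<times> 'a \<times> 'a::comm_ring" where
  "bracket3 x y = (fst x * fst (snd y) - fst (snd x) * fst y,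
     fst x * snd (snd y) - snd (snd x) * fst y,
     snd (snd x) * fst (snd y) - fst (snd x) * snd (snd y))"

abbreviation e_part :: "'a \<times> 'a \<times> 'a \<Rightarrow> 'a" where "e_part x \<equiv> fst x"
abbreviation h_part :: "'a \<times> 'a \<times> 'a \<Rightarrow> 'a" where "h_part x \<equiv> fst (snd x)"
abbreviation f_part :: "'a \<times> 'a \<times> 'a \<Rightarrow> 'a" where "f_part x \<equiv> snd (snd x)"
abbreviation e :: "'a::zero \<Rightarrow> 'a \<times> 'a \<times> 'a" where "e a \<equiv> (a, 0, 0)"
abbreviation h :: "'a::zero \<Rightarrow> 'a \<times> 'a \<times> 'a" where "h a \<equiv> (0, a, 0)"
abbreviation f :: "'a::zero \<Rightarrow> 'a \<times> 'a \<times> 'a" where "f a \<equiv> (0, 0, a)"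

lemma zero3: "(0, 0, 0) = (0 :: 'a::zero \<times> 'a \<times> 'a)"
  by (simp add: zero_prod_def)

lemma triple_eqI: "e_part x = e_part y \<Longrightarrow> h_part x = h_part y \<Longrightarrow> f_part x = f_part y \<Longrightarrow> x = y"
  by (simp add: prod_eq_iff)

text \<open>
  Exchanging \<open>e\<close> and \<open>f\<close> is an automorphism of \<open>S\<close> in characteristic 2. It turns statements about
  components of positive degree into statements about components of negative degree.
\<close>
definition mirror :: "'a \<times> 'a \<times> 'a \<Rightarrow> 'a \<times> 'a \<times> 'a" where
  "mirror x = (f_part x, h_part x, e_part x)"

lemma mirror_mirror [simp]: "mirror (mirror x) = x" and mirror_add: "mirror (x + y) = mirror x + mirror y"
  and mirror_zero: "mirror 0 = 0"
  and mirror_parts [simp]: "e_part (mirror x) = f_part x" "h_part (mirror x) = h_part x" "f_part (mirror x) = e_part x"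
  and mirror_basis [simp]: "mirror (e a) = f a" "mirror (h a) = h a" "mirror (f a) = e a"
  by (simp_all add: mirror_def zero_prod_def prod_eq_iff)

text \<open>
  The cochain \<open>(x \<otimes> a, y \<otimes> b) \<mapsto> [x, y] \<otimes> \<beta>(a, b)\<close> for symmetric \<open>\<beta>\<close>.
\<close>
definition twisted_bracket :: "('a \<Rightarrow> 'a \<Rightarrow> 'a) \<Rightarrow> 'a \<times> 'a \<times> 'a \<Rightarrow> 'a \<times> 'a \<times> 'a \<Rightarrow> 'a \<times> 'a \<times> 'a::comm_ring" where
  "twisted_bracket \<beta> x y = (\<beta> (e_part x) (h_part y) + \<beta> (h_part x) (e_part y),
     \<beta> (e_part x) (f_part y) + \<beta> (f_part x) (e_part y),
     \<beta> (f_part x) (h_part y) + \<beta> (h_part x) (f_part y))"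

text \<open>
  The Chevalley--Eilenberg differential of a 1-cochain, with the signs of characteristic 2.
\<close>
definition cobound :: "('a \<times> 'a \<times> 'a \<Rightarrow> 'a \<times> 'a \<times> 'a) \<Rightarrow> 'a \<times> 'a \<times> 'a \<Rightarrow> 'a \<times> 'a \<times> 'a \<Rightarrow> 'a \<times> 'a \<times> 'a::comm_ring" where
  "cobound \<omega> x y = bracket3 x (\<omega> y) + bracket3 y (\<omega> x) + \<omega> (bracket3 x y)"

context char2_algebra
begin

lemma add_self3 [simp]: "x + x = (0 :: 'a \<times> 'a \<times> 'a)"
  by (rule triple_eqI) simp_all

lemma add_self_left3 [simp]: "x + (x + y) = (y :: 'a \<times> 'a \<times> 'a)"
  by (rule triple_eqI) simp_all

lemma minus_eq3 [simp]: "- x = (x :: 'a \<times> 'a \<times> 'a)" "x - y = x + (y :: 'a \<times> 'a \<times> 'a)"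
  by (rule triple_eqI, simp_all)+

lemma sum_zeroD3: "x + y = 0 \<Longrightarrow> x = (y :: 'a \<times> 'a \<times> 'a)"
  by (rule triple_eqI; rule sum_zeroD) (simp_all flip: fst_add snd_add)

lemma scale3_parts [simp]: "e_part (scale3 s c x) = s c (e_part x)" "h_part (scale3 s c x) = s c (h_part x)"
  "f_part (scale3 s c x) = s c (f_part x)"
  by (simp_all add: scale3_def)

lemma vector_space_scale3: "vector_space (scale3 s)"
  by standard (auto intro!: triple_eqI simp: scale_right_distrib scale_left_distrib)

lemma bracket_add_left: "bracket3 (x + y) z = bracket3 x z + bracket3 y z"
  and bracket_add_right: "bracket3 z (x + y) = bracket3 z x + bracket3 z (y :: 'a \<times> 'a \<times> 'a)"
  by (simp_all add: bracket3_def algebra_simps)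

lemma bracket_scale_left: "bracket3 (scale3 s c x) y = scale3 s c (bracket3 x y)"
  and bracket_scale_right: "bracket3 x (scale3 s c y) = scale3 s c (bracket3 x y)"
  by (simp_all add: bracket3_def scale3_def scale_right_distrib flip: scale_mult_left scale_mult_right)

lemma bracket_self [simp]: "bracket3 x x = (0 :: 'a \<times> 'a \<times> 'a)"
  by (simp add: bracket3_def mult.commute zero_prod_def)

lemma bracket_commute: "bracket3 x y = bracket3 y (x :: 'a \<times> 'a \<times> 'a)"
  by (simp add: bracket3_def ac_simps)

lemma bracket_zero [simp]: "bracket3 x 0 = (0 :: 'a \<times> 'a \<times> 'a)" "bracket3 0 x = (0 :: 'a \<times> 'a \<times> 'a)"
  by (simp_all add: bracket3_def zero_prod_def)

lemma jacobi: "bracket3 (bracket3 x y) z = bracket3 x (bracket3 y z) + bracket3 y (bracket3 x (z :: 'a \<times> 'a \<times> 'a))"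
  by (simp add: bracket3_def algebra_simps)

lemma mirror_bracket: "bracket3 (mirror x) (mirror y) = mirror (bracket3 x (y :: 'a \<times> 'a \<times> 'a))"
  by (simp add: bracket3_def mirror_def ac_simps)

lemma mirror_scale: "mirror (scale3 s c x) = scale3 s c (mirror x)"
  by (simp add: mirror_def scale3_def)

end

section \<open>Components of 2-cocycles by degree\<close>

text \<open>
  The cocycle condition has no signs, since they are trivial in characteristic 2.
\<close>
locale cocycle2 = char2_algebra s
  for s :: "'k::field \<Rightarrow> 'a \<Rightarrow> 'a::{comm_ring, comm_monoid_mult}" +
  fixes \<psi> :: "'a \<times> 'a \<times> 'a \<Rightarrow> 'a \<times> 'a \<times> 'a \<Rightarrow> 'a \<times> 'a \<times> 'a"
  assumes add_left: "\<psi> (x + y) z = \<psi> x z + \<psi> y z"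
    and add_right: "\<psi> z (x + y) = \<psi> z x + \<psi> z y"
    and scl_left: "\<psi> (scale3 s c x) z = scale3 s c (\<psi> x z)"
    and scl_right: "\<psi> z (scale3 s c x) = scale3 s c (\<psi> z x)"
    and alt: "\<psi> x x = 0"
    and cocycle: "bracket3 x (\<psi> y z) + bracket3 y (\<psi> x z) + bracket3 z (\<psi> x y)
      + \<psi> (bracket3 x y) z + \<psi> (bracket3 x z) y + \<psi> (bracket3 y z) x = 0"
begin

lemma commute: "\<psi> x y = \<psi> y x"
proof (rule sum_zeroD3)
  show "\<psi> x y + \<psi> y x = 0" using alt[of "x + y"] by (simp add: add_left add_right alt[of x] alt[of y] add.commute)
qed

lemmas orient = commute[of "f a" "e b" for a b] commute[of "h a" "e b" for a b] commute[of "h a" "f b" for a b]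

lemma zero_left [simp]: "\<psi> 0 x = 0" using add_left[of 0 0 x] by simp

lemma zero_right [simp]: "\<psi> x 0 = 0" using add_right[of x 0 0] by simp

lemma zeros [simp]: "\<psi> (0, 0, 0) x = 0" "\<psi> x (0, 0, 0) = 0" by (simp_all add: zero3)

lemma mirror_cocycle: "cocycle2 s (\<lambda>x y. mirror (\<psi> (mirror x) (mirror y)))"
proof
  fix x y z
  show "bracket3 x (mirror (\<psi> (mirror y) (mirror z))) + bracket3 y (mirror (\<psi> (mirror x) (mirror z)))
      + bracket3 z (mirror (\<psi> (mirror x) (mirror y)))
      + mirror (\<psi> (mirror (bracket3 x y)) (mirror z)) + mirror (\<psi> (mirror (bracket3 x z)) (mirror y))
      + mirror (\<psi> (mirror (bracket3 y z)) (mirror x)) = 0"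
    using arg_cong[OF cocycle[of "mirror x" "mirror y" "mirror z"], of mirror]
    by (simp add: mirror_add mirror_zero flip: mirror_bracket)
qed (simp_all add: mirror_add mirror_scale mirror_zero add_left add_right scl_left scl_right alt)

text \<open>
  In this and the following lemmas the functional equations are the components of the cocycle
  condition at triples of basis vectors; the degree of a component is that of its value minus
  those of its arguments.
\<close>
lemma degree3: "e_part (\<psi> (f a) (f b)) = 0"
proof (rule degree3_vanishes[where X = "\<lambda>a b. e_part (\<psi> (f a) (f b))"])
  fix a b c
  show "a * e_part (\<psi> (f b) (f c)) + b * e_part (\<psi> (f a) (f c)) + c * e_part (\<psi> (f a) (f b)) = 0"
    using arg_cong[OF cocycle[of "f a" "f b" "f c"], of "\<lambda>v. h_part v"] by (simp add: bracket3_def)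
  show "c * e_part (\<psi> (f a) (f b)) + e_part (\<psi> (f (a * c)) (f b)) + e_part (\<psi> (f (b * c)) (f a)) = 0"
    using arg_cong[OF cocycle[of "f a" "f b" "h c"], of "\<lambda>v. e_part v"]
    by (simp add: bracket3_def ac_simps)
qed (simp add: alt)

lemma degree2:
  assumes "\<And>b. e_part (\<psi> (f 1) (h b)) = 0"
  shows "e_part (\<psi> (f a) (h b)) = 0" "h_part (\<psi> (f a) (f b)) = 0"
proof -
  note * = degree2_vanishes[where N = "\<lambda>a b. e_part (\<psi> (f a) (h b))" and M = "\<lambda>a b. h_part (\<psi> (f a) (f b))"]
  have i: "a * h_part (\<psi> (f b) (f c)) + e_part (\<psi> (f c) (h (a * b))) + e_part (\<psi> (f b) (h (a * c))) = 0" for a b c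
    using arg_cong[OF cocycle[of "e a" "f b" "f c"], of "\<lambda>v. e_part v"]
    by (simp add: bracket3_def orient ac_simps)
  have ii: "b * e_part (\<psi> (f a) (h c)) + c * e_part (\<psi> (f a) (h b)) + e_part (\<psi> (f (a * b)) (h c))
      + e_part (\<psi> (f (a * c)) (h b)) = 0" for a b c
    using arg_cong[OF cocycle[of "f a" "h b" "h c"], of "\<lambda>v. e_part v"]
    by (simp add: bracket3_def orient ac_simps)
  show "e_part (\<psi> (f a) (h b)) = 0" "h_part (\<psi> (f a) (f b)) = 0"
    by (rule *; fact i ii assms)+
qed

text \<open>
  Stated without normalisation because its instance \<open>a = b = c = 1\<close> is needed to see that the two
  values normalised in degree one can be removed simultaneously.
\<close>
lemma degree1_eq: 
  "a * h_part (\<psi> (f c) (h b)) + b * e_part (\<psi> (e a) (f c)) + e_part (\<psi> (e (a * b)) (f c))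
    + e_part (\<psi> (h (a * c)) (h b)) + e_part (\<psi> (e a) (f (b * c))) = 0"
  using arg_cong[OF cocycle[of "e a" "h b" "f c"], of "\<lambda>v. e_part v"]
  by (simp add: bracket3_def orient ac_simps)

lemma degree1:
  assumes "\<And>a. h_part (\<psi> (f a) (h 1)) = 0" "\<And>a. e_part (\<psi> (e a) (f 1)) = 0"
  shows "e_part (\<psi> (e a) (f b)) = 0" "f_part (\<psi> (f a) (f b)) = 0"
    "h_part (\<psi> (f a) (h b)) = 0" "e_part (\<psi> (h a) (h b)) = 0"
proof -
  note * = degree1_vanishes[where E = "\<lambda>a b. e_part (\<psi> (e a) (f b))" and F = "\<lambda>a b. f_part (\<psi> (f a) (f b))"
    and G = "\<lambda>a b. h_part (\<psi> (f a) (h b))" and H = "\<lambda>a b. e_part (\<psi> (h a) (h b))"]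
  have C: "a * e_part (\<psi> (e c) (f b)) + b * e_part (\<psi> (e c) (f a)) + c * f_part (\<psi> (f a) (f b))
    + h_part (\<psi> (f b) (h (a * c))) + h_part (\<psi> (f a) (h (b * c))) = 0" for a b c
    using arg_cong[OF cocycle[of "f a" "f b" "e c"], of "\<lambda>v. h_part v"]
    by (simp add: bracket3_def orient ac_simps)
  have D: "a * e_part (\<psi> (h b) (h c)) + h_part (\<psi> (f (a * b)) (h c)) + h_part (\<psi> (f (a * c)) (h b)) = 0" for a b c
    using arg_cong[OF cocycle[of "f a" "h b" "h c"], of "\<lambda>v. h_part v"]
    by (simp add: bracket3_def orient ac_simps)
  have I: "a * e_part (\<psi> (h b) (h c)) + b * e_part (\<psi> (h a) (h c)) + c * e_part (\<psi> (h a) (h b)) = 0" for a b c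
    using arg_cong[OF cocycle[of "h a" "h b" "h c"], of "\<lambda>v. e_part v"]
    by (simp add: bracket3_def orient ac_simps)
  show "e_part (\<psi> (e a) (f b)) = 0" "f_part (\<psi> (f a) (f b)) = 0"
    "h_part (\<psi> (f a) (h b)) = 0" "e_part (\<psi> (h a) (h b)) = 0"
    by (rule *; fact degree1_eq C D I assms)+
qed

lemma degree0:
  assumes "\<And>c. h_part (\<psi> (e 1) (f c)) = 0" "\<And>c. h_part (\<psi> (e c) (f 1)) = 0" "e_part (\<psi> (e 1) (h 1)) = 0"
  defines "R \<equiv> \<lambda>a b. h_part (\<psi> (e a) (f b))"
  shows "e_part (\<psi> (e a) (h b)) = R a b" "f_part (\<psi> (f a) (h b)) = R a b" "R a b = R b a" "h_part (\<psi> (h a) (h b)) = 0"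
    and "a * R b c + R (a * b) c + R a (b * c) + R a b * c = 0"
proof -
  note * = degree0_symmetric[where P = "\<lambda>a b. e_part (\<psi> (e a) (h b))" and Q = "\<lambda>a b. f_part (\<psi> (f a) (h b))"
    and R = R and T = "\<lambda>a b. h_part (\<psi> (h a) (h b))"]
  have I: "a * h_part (\<psi> (h b) (h c)) + b * e_part (\<psi> (e a) (h c)) + c * e_part (\<psi> (e a) (h b))
    + e_part (\<psi> (e (a * b)) (h c)) + e_part (\<psi> (e (a * c)) (h b)) = 0" for a b c
    using arg_cong[OF cocycle[of "e a" "h b" "h c"], of "\<lambda>v. e_part v"]
    by (simp add: bracket3_def orient ac_simps)
  have I': "a * h_part (\<psi> (h b) (h c)) + b * f_part (\<psi> (f a) (h c)) + c * f_part (\<psi> (f a) (h b))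
    + f_part (\<psi> (f (a * b)) (h c)) + f_part (\<psi> (f (a * c)) (h b)) = 0" for a b c
    using arg_cong[OF cocycle[of "f a" "h b" "h c"], of "\<lambda>v. f_part v"]
    by (simp add: bracket3_def orient ac_simps)
  have II: "a * f_part (\<psi> (f c) (h b)) + c * e_part (\<psi> (e a) (h b)) + R (a * b) c + R a (b * c)
    + h_part (\<psi> (h (a * c)) (h b)) = 0" for a b c
    using arg_cong[OF cocycle[of "e a" "h b" "f c"], of "\<lambda>v. h_part v"]
    by (simp add: bracket3_def orient ac_simps R_def)
  have III: "a * R b c + b * R a c + e_part (\<psi> (e b) (h (a * c))) + e_part (\<psi> (e a) (h (b * c))) = 0" for a b c
    using arg_cong[OF cocycle[of "e a" "e b" "f c"], of "\<lambda>v. e_part v"]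
    by (simp add: bracket3_def orient ac_simps R_def)
  have III': "a * R c b + b * R c a + f_part (\<psi> (f b) (h (a * c))) + f_part (\<psi> (f a) (h (b * c))) = 0" for a b c
    using arg_cong[OF cocycle[of "f a" "f b" "e c"], of "\<lambda>v. f_part v"]
    by (simp add: bracket3_def orient ac_simps R_def)
  have Tsym: "h_part (\<psi> (h a) (h b)) = h_part (\<psi> (h b) (h a))" for a b by (simp add: commute)
  note hyps = I I' II III III' Tsym assms(1-3)[folded R_def]
  show "e_part (\<psi> (e a) (h b)) = R a b" "f_part (\<psi> (f a) (h b)) = R a b" "R a b = R b a" "h_part (\<psi> (h a) (h b)) = 0"
    "a * R b c + R (a * b) c + R a (b * c) + R a b * c = 0"
    by (rule *; (fact hyps | simp add: R_def assms(1-3)))+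
qed

end

section \<open>The normal form of a 2-cocycle\<close>

text \<open>
  The component \<open>e, f \<mapsto> h\<close> corrected so that it vanishes when an argument is \<open>1\<close>. The correction
  cancels the contribution of the parts \<open>e \<mapsto> e\<close> and \<open>f \<mapsto> f\<close> of a 1-cochain, which are independent
  of its part \<open>h \<mapsto> h\<close>.
\<close>
definition harrison :: "('a \<times> 'a \<times> 'a \<Rightarrow> 'a \<times> 'a \<times> 'a \<Rightarrow> 'a \<times> 'a \<times> 'a::{comm_ring, comm_monoid_mult}) \<Rightarrow> 'a \<Rightarrow> 'a \<Rightarrow> 'a" where
  "harrison \<psi> a b = h_part (\<psi> (e a) (f b)) + a * h_part (\<psi> (e 1) (f b)) + b * h_part (\<psi> (e a) (f 1))
     + a * b * h_part (\<psi> (e 1) (f 1))"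

text \<open>
  The 1-cochain whose coboundary normalises \<open>\<psi>\<close>. Its entries solve the equations saying that a
  component of \<open>\<psi> + d\<omega>\<close> vanishes, or is a multiple of one of the two invariants, when one argument
  lies in \<open>S \<otimes> 1\<close>. The terms in which both arguments of \<open>\<psi>\<close> lie in \<open>S \<otimes> 1\<close> compensate for the
  multiples of values of \<open>\<omega>\<close> on \<open>S \<otimes> 1\<close> in those equations.
\<close>
definition normaliser :: "('a \<times> 'a \<times> 'a \<Rightarrow> 'a \<times> 'a \<times> 'a \<Rightarrow> 'a \<times> 'a \<times> 'a::{comm_ring, comm_monoid_mult}) \<Rightarrow> 'a \<times> 'a \<times> 'a \<Rightarrow> 'a \<times> 'a \<times> 'a" where
  "normaliser \<psi> x =
    (h_part (\<psi> (e (e_part x)) (f 1)) + e_part x * h_part (\<psi> (e 1) (f 1))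
       + e_part (\<psi> (e (h_part x)) (f 1)) + h_part x * h_part (\<psi> (f 1) (h 1))
       + e_part (\<psi> (f 1) (h (f_part x))) + f_part x * e_part (\<psi> (f 1) (h 1)),
     h_part (\<psi> (e (e_part x)) (h 1)) + h_part x * e_part (\<psi> (e 1) (h 1)) + h_part (\<psi> (f (f_part x)) (h 1)),
     f_part (\<psi> (e 1) (h (e_part x))) + e_part x * f_part (\<psi> (e 1) (h 1))
       + f_part (\<psi> (e 1) (f (h_part x))) + h_part x * h_part (\<psi> (e 1) (h 1))
       + h_part (\<psi> (e 1) (f (f_part x))) + f_part x * e_part (\<psi> (e 1) (h 1)))"

context char2_algebra
begin

text \<open>
  The terms of \<open>d(d\<omega>)\<close> with two brackets cancel by the Jacobi identity, those with one bracket in pairs.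
\<close>
lemma cobound_cocycle:
  assumes add: "\<And>x y. \<omega> (x + y) = \<omega> x + \<omega> y" and scl: "\<And>c x. \<omega> (scale3 s c x) = scale3 s c (\<omega> x)"
  shows "cocycle2 s (cobound \<omega>)"
proof
  interpret S3: vector_space "scale3 s" by (rule vector_space_scale3)
  have zero: "\<omega> 0 = 0" using add[of 0 0] by simp
  fix x y z c
  show "cobound \<omega> (x + y) z = cobound \<omega> x z + cobound \<omega> y z"
    "cobound \<omega> z (x + y) = cobound \<omega> z x + cobound \<omega> z y"
    by (simp_all add: cobound_def bracket_add_left bracket_add_right add ac_simps)
  show "cobound \<omega> (scale3 s c x) z = scale3 s c (cobound \<omega> x z)"
    "cobound \<omega> z (scale3 s c x) = scale3 s c (cobound \<omega> z x)"
    by (simp_all add: cobound_def bracket_scale_left bracket_scale_right scl S3.scale_right_distrib)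
  show "cobound \<omega> x x = 0" by (simp add: cobound_def zero)
  have expand: "bracket3 z (bracket3 x y) = bracket3 x (bracket3 y z) + bracket3 y (bracket3 x z)" for x y z :: "'a \<times> 'a \<times> 'a"
    using jacobi[of x y z] by (simp add: bracket_commute[of z])
  have "\<omega> (bracket3 (bracket3 x y) z) + \<omega> (bracket3 (bracket3 x z) y) + \<omega> (bracket3 (bracket3 y z) x) = 0"
    by (simp add: jacobi add bracket_commute[of z y] bracket_commute[of z x] bracket_commute[of y x] ac_simps)
  then show "bracket3 x (cobound \<omega> y z) + bracket3 y (cobound \<omega> x z) + bracket3 z (cobound \<omega> x y)
      + cobound \<omega> (bracket3 x y) z + cobound \<omega> (bracket3 x z) y + cobound \<omega> (bracket3 y z) x = 0"
    by (simp add: cobound_def bracket_add_right jacobi ac_simps)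
qed

lemma add_cocycle:
  assumes "cocycle2 s \<phi>" "cocycle2 s \<psi>"
  shows "cocycle2 s (\<lambda>x y. \<phi> x y + \<psi> x y)"
proof -
  interpret A: cocycle2 s \<phi> by fact
  interpret B: cocycle2 s \<psi> by fact
  interpret S3: vector_space "scale3 s" by (rule vector_space_scale3)
  show ?thesis
  proof
    fix x y z
    have "bracket3 x (\<phi> y z) + bracket3 y (\<phi> x z) + bracket3 z (\<phi> x y)
      + \<phi> (bracket3 x y) z + \<phi> (bracket3 x z) y + \<phi> (bracket3 y z) x
      + (bracket3 x (\<psi> y z) + bracket3 y (\<psi> x z) + bracket3 z (\<psi> x y)
      + \<psi> (bracket3 x y) z + \<psi> (bracket3 x z) y + \<psi> (bracket3 y z) x) = 0"
      by (simp only: A.cocycle B.cocycle) simp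
    then show "bracket3 x (\<phi> y z + \<psi> y z) + bracket3 y (\<phi> x z + \<psi> x z) + bracket3 z (\<phi> x y + \<psi> x y)
      + (\<phi> (bracket3 x y) z + \<psi> (bracket3 x y) z) + (\<phi> (bracket3 x z) y + \<psi> (bracket3 x z) y)
      + (\<phi> (bracket3 y z) x + \<psi> (bracket3 y z) x) = 0"
      by (simp add: bracket_add_right ac_simps)
  qed (simp_all add: A.add_left B.add_left A.add_right B.add_right A.scl_left B.scl_left A.scl_right
      B.scl_right S3.scale_right_distrib A.alt B.alt ac_simps)
qed

lemma linear_scale_iff: "Vector_Spaces.linear s s g \<longleftrightarrow> (\<forall>x y. g (x + y) = g x + g y) \<and> (\<forall>c x. g (s c x) = s c (g x))"
  by (simp add: Vector_Spaces.linear_def module_hom_iff vector_space_axioms module_axioms vector_space_pair_def module_hom_axioms_def)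

text \<open>
  By the Hochschild identity \<open>S(a, b, c) = \<beta>(a, bc) + a \<beta>(b, c)\<close> is symmetric in all arguments. The
  cocycle condition is a sum of values of \<open>S\<close> with the structure constants of the Jacobi
  expression as coefficients, so it vanishes.
\<close>
lemma twisted_cocycle:
  assumes "\<beta> \<in> Har2_cocycles s"
  shows "cocycle2 s (twisted_bracket \<beta>)"
proof -
  have lin: "\<beta> a (b + c) = \<beta> a b + \<beta> a c" "\<beta> (b + c) a = \<beta> b a + \<beta> c a"
    "\<beta> a (s k b) = s k (\<beta> a b)" "\<beta> (s k b) a = s k (\<beta> b a)" for a b c k
    using assms by (auto simp: Har2_cocycles_def linear_scale_iff)
  have sym: "\<beta> a b = \<beta> b a" for a b using assms by (auto simp: Har2_cocycles_def)
  have har: "a * \<beta> b c + \<beta> (a * b) c + \<beta> a (b * c) + \<beta> a b * c = 0" for a b c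
    using assms by (auto simp: Har2_cocycles_def)
  define S where "S a b c = \<beta> a (b * c) + a * \<beta> b c" for a b c
  have mult: "\<beta> a (b * c) = S a b c + a * \<beta> b c" "\<beta> (b * c) a = S a b c + a * \<beta> b c" for a b c
    by (simp_all add: S_def sym[of "b * c" a] ac_simps)
  have S1: "S a b c = S a c b" for a b c by (simp add: S_def sym[of c b] mult.commute)
  have S2: "S a b c = S b a c" for a b c
    by (rule sum_zeroD) (use har[of a c b] in \<open>simp add: S_def sym[of "a * c" b] sym[of c b] ac_simps\<close>)
  show ?thesis
  proof
    fix x y z c
    show "twisted_bracket \<beta> (x + y) z = twisted_bracket \<beta> x z + twisted_bracket \<beta> y z"
      "twisted_bracket \<beta> z (x + y) = twisted_bracket \<beta> z x + twisted_bracket \<beta> z y"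
      by (simp_all add: twisted_bracket_def lin ac_simps)
    show "twisted_bracket \<beta> (scale3 s c x) z = scale3 s c (twisted_bracket \<beta> x z)"
      "twisted_bracket \<beta> z (scale3 s c x) = scale3 s c (twisted_bracket \<beta> z x)"
      by (simp_all add: twisted_bracket_def lin scale3_def scale_right_distrib)
    show "twisted_bracket \<beta> x x = 0" by (simp add: twisted_bracket_def sym zero_prod_def)
    show "bracket3 x (twisted_bracket \<beta> y z) + bracket3 y (twisted_bracket \<beta> x z) + bracket3 z (twisted_bracket \<beta> x y)
      + twisted_bracket \<beta> (bracket3 x y) z + twisted_bracket \<beta> (bracket3 x z) y + twisted_bracket \<beta> (bracket3 y z) x = 0"
      by (rule triple_eqI) (simp_all add: twisted_bracket_def bracket3_def lin mult distrib_left S1 S2 sym ac_simps)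
  qed
qed

text \<open>
  A linear map \<open>\<eta>\<close> applied to all three coefficients realises the Hochschild coboundary of \<open>\<eta>\<close>.
\<close>
lemma twisted_Har2_coboundary:
  assumes add: "\<And>x y::'a. \<eta> (x + y) = \<eta> x + (\<eta> y::'a)"
  shows "twisted_bracket (\<lambda>a b. a * \<eta> b + \<eta> (a * b) + \<eta> a * b) x y
    = cobound (\<lambda>x. (\<eta> (e_part x), \<eta> (h_part x), \<eta> (f_part x))) x y"
  by (simp add: twisted_bracket_def cobound_def bracket3_def add algebra_simps)

end

context cocycle2
begin

lemma basis_linear:
  "e (a + b) = e a + e (b::'a)" "h (a + b) = h a + h (b::'a)" "f (a + b) = f a + f (b::'a)"
  "e (s c a) = scale3 s c (e a)" "h (s c a) = scale3 s c (h a)" "f (s c a) = scale3 s c (f a)"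
  by (simp_all add: scale3_def)

lemma normaliser_linear:
  shows normaliser_add: "normaliser \<psi> (x + y) = normaliser \<psi> x + normaliser \<psi> y"
    and normaliser_scale: "normaliser \<psi> (scale3 s c x) = scale3 s c (normaliser \<psi> x)"
proof -
  show "normaliser \<psi> (x + y) = normaliser \<psi> x + normaliser \<psi> y"
    by (rule triple_eqI)
      (simp_all add: normaliser_def basis_linear add_left add_right distrib_right ac_simps del: add_Pair)
  show "normaliser \<psi> (scale3 s c x) = scale3 s c (normaliser \<psi> x)"
    by (rule triple_eqI)
      (simp_all add: normaliser_def basis_linear scl_left scl_right scale_right_distrib scale_mult_left)
qed

definition normalised :: "'a \<times> 'a \<times> 'a \<Rightarrow> 'a \<times> 'a \<times> 'a \<Rightarrow> 'a \<times> 'a \<times> 'a" where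
  "normalised x y = \<psi> x y + cobound (normaliser \<psi>) x y"

lemma normalised_cocycle: "cocycle2 s normalised"
  unfolding normalised_def
  by (intro add_cocycle cobound_cocycle normaliser_linear) unfold_locales

interpretation N: cocycle2 s normalised by (rule normalised_cocycle)

lemma degree1_value: "e_part (\<psi> (e 1) (f 1)) = h_part (\<psi> (f 1) (h 1))"
  by (rule sum_zeroD) (use degree1_eq[of 1 1 1] in \<open>simp add: alt ac_simps\<close>)

lemma degree1_value': "f_part (\<psi> (e 1) (f 1)) = h_part (\<psi> (e 1) (h 1))"
  using cocycle2.degree1_value[OF mirror_cocycle] by (simp add: orient)

lemmas normalised_simps = normalised_def cobound_def normaliser_def bracket3_def

text \<open>
  The last two values are proportional to the two invariants. They are the only obstruction to a
  complete normalisation.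
\<close>
lemma normalised_values:
  "h_part (normalised (e 1) (f c)) = 0" "h_part (normalised (e c) (f 1)) = 0" "e_part (normalised (e 1) (h 1)) = 0"
  "h_part (normalised (f c) (h 1)) = 0" "e_part (normalised (e c) (f 1)) = 0"
  "h_part (normalised (e c) (h 1)) = 0" "f_part (normalised (e 1) (f c)) = 0"
  "e_part (normalised (f 1) (h c)) = c * e_part (\<psi> (f 1) (h 1))"
  "f_part (normalised (e 1) (h c)) = c * f_part (\<psi> (e 1) (h 1))"
  by (simp_all add: normalised_simps degree1_value degree1_value' distrib_left ac_simps)

lemma harrison_normalised: "h_part (normalised (e a) (f b)) = harrison \<psi> a b"
  by (simp add: normalised_simps harrison_def distrib_left ac_simps)

lemma harrison_cocycle: "harrison \<psi> \<in> Har2_cocycles s"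
proof -
  note n = N.degree0[OF normalised_values(1-3), unfolded harrison_normalised]
  have "harrison \<psi> a (b + c) = harrison \<psi> a b + harrison \<psi> a c" "harrison \<psi> (b + c) a = harrison \<psi> b a + harrison \<psi> c a"
    "harrison \<psi> a (s k b) = s k (harrison \<psi> a b)" "harrison \<psi> (s k b) a = s k (harrison \<psi> b a)" for a b c k
    by (simp_all only: basis_linear N.add_left N.add_right N.scl_left N.scl_right fst_add snd_add scale3_parts
        flip: harrison_normalised)
  then show ?thesis using n(3,5) by (auto simp: Har2_cocycles_def linear_scale_iff)
qed

text \<open>
  Positive degrees vanish by the preceding lemmas, negative ones by the same lemmas for the
  mirrored cocycle, and degree zero is the twisted bracket.
\<close>
theorem normal_form:
  assumes "e_part (\<psi> (f 1) (h 1)) = 0" "f_part (\<psi> (e 1) (h 1)) = 0"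
  shows "\<psi> x y = twisted_bracket (harrison \<psi>) x y + cobound (normaliser \<psi>) x y"
proof -
  let ?n = normalised
  interpret M: cocycle2 s "\<lambda>x y. mirror (?n (mirror x) (mirror y))" by (rule N.mirror_cocycle)
  note n0 = N.degree0(1-4)[OF normalised_values(1-3), unfolded harrison_normalised]
  note n1 = N.degree1[OF normalised_values(4,5)]
  note n2 = N.degree2[OF normalised_values(8)[unfolded assms(1) mult_zero_right]]
  have v: "h_part (mirror (?n (mirror (f c)) (mirror (h 1)))) = 0" "e_part (mirror (?n (mirror (e c)) (mirror (f 1)))) = 0"
    "e_part (mirror (?n (mirror (f 1)) (mirror (h c)))) = 0" for c
    using normalised_values(6,7,9)[of c] assms(2) by (simp_all add: N.orient)
  note m1 = M.degree1[OF v(1,2), simplified, simplified N.orient]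
  note m2 = M.degree2[OF v(3), simplified, simplified N.orient]
  note m3 = M.degree3[simplified]
  obtain x1 x2 x3 y1 y2 y3 where xy: "x = (x1, x2, x3)" "y = (y1, y2, y3)" by (cases x; cases y)
  have split: "x = e x1 + (h x2 + f x3)" "y = e y1 + (h y2 + f y3)" by (simp_all add: xy)
  have "?n x y = twisted_bracket (harrison \<psi>) x y"
    unfolding split N.add_left N.add_right
    by (rule triple_eqI)
      (simp_all add: twisted_bracket_def n0 n1 n2 m1 m2 m3 N.degree3 N.orient harrison_normalised)
  then have "\<psi> x y + cobound (normaliser \<psi>) x y + cobound (normaliser \<psi>) x y = twisted_bracket (harrison \<psi>) x y + cobound (normaliser \<psi>) x y"
    by (simp only: normalised_def)
  then show ?thesis by (simp add: add.assoc)
qed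

end

section \<open>Cochains of low degree\<close>

definition scale2 :: "('k \<Rightarrow> 'a \<Rightarrow> 'a) \<Rightarrow> 'k \<Rightarrow> 'a \<times> 'a \<Rightarrow> 'a \<times> 'a" where
  "scale2 s c x = (s c (fst x), s c (snd x))"

definition S_over :: "('k \<Rightarrow> 'a \<Rightarrow> 'a) \<Rightarrow> ('k, 'a \<times> 'a \<times> 'a::comm_ring) lie_alg" where
  "S_over s = vspace.extend (class_vs (scale3 s) UNIV) \<lparr>brk = bracket3\<rparr>"

lemma S_over_simps [simp]:
  "carr (S_over s) = UNIV" "add (S_over s) = (+)" "zro (S_over s) = 0" "scl (S_over s) = scale3 s"
  "brk (S_over s) = bracket3"
  by (simp_all add: S_over_def vspace.defs lie_alg.defs class_vs_def)

lemma S_alg_eq_S_over: "S_alg = S_over (*)"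
  by (simp add: S_alg_def S_over_def S_bracket_def bracket3_def scale3_def fun_eq_iff lie_alg.defs
      vspace.defs class_vs_def case_prod_beta)

lemma args_S_over [simp]: "args (S_over s) n = {xs. length xs = n}"
  by (simp add: args_def)

context char2_algebra
begin

\<comment> \<open>Quantified triples stay whole, so that additivity remains usable for rewriting.\<close>
declare split_paired_All [simp del] split_paired_Ex [simp del] split_paired_all [simp del]

abbreviation L where "L \<equiv> S_over s"
abbreviation scale_fun where "scale_fun \<equiv> \<lambda>c (\<phi> :: ('a \<times> 'a \<times> 'a) list \<Rightarrow> 'a \<times> 'a \<times> 'a) xs. scale3 s c (\<phi> xs)"

interpretation S3: vector_space "scale3 s" by (rule vector_space_scale3)

lemma module_scale_fun: "module scale_fun"
  by standard (simp_all add: fun_eq_iff S3.scale_right_distrib S3.scale_left_distrib)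

lemma CE_cohomology_eq:
  "CE_cohomology L n = quotient (class_vs scale_fun (CE_cocycles L n)) (CE_coboundaries L n)"
proof -
  have "(\<lambda>(\<phi> :: ('a \<times> 'a \<times> 'a) list \<Rightarrow> 'a \<times> 'a \<times> 'a) \<psi> xs. \<phi> xs + \<psi> xs) = (+)" by (simp add: fun_eq_iff)
  then show ?thesis by (simp add: CE_cohomology_def cochains_def class_vs_def zero_fun_def)
qed

lemma scale3_minus_power [simp]: "scale3 s ((-1) ^ k) x = x"
proof -
  have "1 + 1 = (0::'k)" using of_nat_CHAR[where ?'a = 'k] by (simp add: char2)
  then have "- 1 = (1::'k)" by (rule minus_unique)
  then show ?thesis by (simp only: power_one S3.scale_one)
qed

lemma args_all: "(\<forall>xs. length xs = Suc 0 \<longrightarrow> P xs) \<longleftrightarrow> (\<forall>x. P [x])"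
  "(\<forall>xs. length xs = 2 \<longrightarrow> P xs) \<longleftrightarrow> (\<forall>x y. P [x, y])"
  "(\<forall>xs. length xs = 3 \<longrightarrow> P xs) \<longleftrightarrow> (\<forall>x y z. P [x, y, z])"
  by (auto simp: length_Suc_conv numeral_2_eq_2 numeral_3_eq_3)

lemma cochains_0_iff: "\<phi> \<in> carr (cochains L 0) \<longleftrightarrow> (\<forall>xs. length xs \<noteq> 0 \<longrightarrow> \<phi> xs = 0)"
  by (simp add: cochains_def multilinear_def alternating_def)

lemma cochains_1_iff: "\<phi> \<in> carr (cochains L 1) \<longleftrightarrow> (\<forall>xs. length xs \<noteq> 1 \<longrightarrow> \<phi> xs = 0) \<and>
    (\<forall>x y. \<phi> [x + y] = \<phi> [x] + \<phi> [y]) \<and> (\<forall>c x. \<phi> [scale3 s c x] = scale3 s c (\<phi> [x]))"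
  by (auto simp: cochains_def multilinear_def alternating_def args_all)

lemma cochains_2_iff: "\<phi> \<in> carr (cochains L 2) \<longleftrightarrow> (\<forall>xs. length xs \<noteq> 2 \<longrightarrow> \<phi> xs = 0) \<and>
    (\<forall>x y z. \<phi> [x + y, z] = \<phi> [x, z] + \<phi> [y, z]) \<and> (\<forall>z x y. \<phi> [z, x + y] = \<phi> [z, x] + \<phi> [z, y]) \<and>
    (\<forall>c x z. \<phi> [scale3 s c x, z] = scale3 s c (\<phi> [x, z])) \<and>
    (\<forall>z c x. \<phi> [z, scale3 s c x] = scale3 s c (\<phi> [z, x])) \<and> (\<forall>x. \<phi> [x, x] = 0)"
proof -
  have "alternating L 2 \<phi> \<longleftrightarrow> (\<forall>x. \<phi> [x, x] = 0)"
  proof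
    assume alt: "alternating L 2 \<phi>"
    have "\<phi> [x, x] = 0" for x
      using alt[unfolded alternating_def, rule_format, of "[x, x]" 0 1] by simp
    then show "\<forall>x. \<phi> [x, x] = 0" ..
  next
    assume "\<forall>x. \<phi> [x, x] = 0"
    then show "alternating L 2 \<phi>"
      unfolding alternating_def by (auto simp: args_all less_2_cases_iff)
  qed
  moreover have "multilinear L 2 \<phi> \<longleftrightarrow> (\<forall>x y z. \<phi> [x + y, z] = \<phi> [x, z] + \<phi> [y, z]) \<and> (\<forall>z x y. \<phi> [z, x + y] = \<phi> [z, x] + \<phi> [z, y]) \<and>
    (\<forall>c x z. \<phi> [scale3 s c x, z] = scale3 s c (\<phi> [x, z])) \<and>
    (\<forall>z c x. \<phi> [z, scale3 s c x] = scale3 s c (\<phi> [z, x]))"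
  proof -
    have two: "(\<forall>i<2. P i) \<longleftrightarrow> P 0 \<and> P (1::nat)" for P by (auto simp: less_2_cases_iff)
    show ?thesis by (simp add: multilinear_def args_all two) blast
  qed
  ultimately show ?thesis by (auto simp: cochains_def)
qed

lemma CE_diff_0: "CE_diff L 0 \<phi> = (\<lambda>xs. if length xs = 1 then bracket3 (xs ! 0) (\<phi> []) else 0)"
  by (auto simp: CE_diff_def vsum_def fun_eq_iff length_Suc_conv nths_Cons)

lemma CE_diff_1: "CE_diff L 1 \<phi> = (\<lambda>xs. if length xs = 2 then cobound (\<lambda>x. \<phi> [x]) (xs ! 0) (xs ! 1) else 0)"
  by (auto simp: CE_diff_def vsum_def fun_eq_iff length_Suc_conv nths_Cons numeral_2_eq_2 cobound_def ac_simps)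

lemma CE_diff_2: "CE_diff L 2 \<phi> [x, y, z] =
   bracket3 x (\<phi> [y, z]) + bracket3 y (\<phi> [x, z]) + bracket3 z (\<phi> [x, y])
      + \<phi> [bracket3 x y, z] + \<phi> [bracket3 x z, y] + \<phi> [bracket3 y z, x]"
  by (simp add: CE_diff_def vsum_def nths_Cons numeral_2_eq_2 ac_simps)

lemma CE_diff_2_other: "length xs \<noteq> 3 \<Longrightarrow> CE_diff L 2 \<phi> xs = 0"
  by (simp add: CE_diff_def)

lemma cocycles_1_iff: "\<phi> \<in> CE_cocycles L 1 \<longleftrightarrow> \<phi> \<in> carr (cochains L 1) \<and> (\<forall>x y. cobound (\<lambda>x. \<phi> [x]) x y = 0)"
  unfolding CE_cocycles_def CE_diff_1 using args_all(2)[of "\<lambda>xs. cobound (\<lambda>x. \<phi> [x]) (xs ! 0) (xs ! 1) = 0"]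
  by auto

lemma cocycles_2_iff: "\<phi> \<in> CE_cocycles L 2 \<longleftrightarrow> (\<forall>xs. length xs \<noteq> 2 \<longrightarrow> \<phi> xs = 0) \<and> cocycle2 s (\<lambda>x y. \<phi> [x, y])"
proof -
  have eq: "(\<forall>xs. CE_diff L 2 \<phi> xs = 0) \<longleftrightarrow> (\<forall>x y z. CE_diff L 2 \<phi> [x, y, z] = 0)"
    using args_all(3)[of "\<lambda>xs. CE_diff L 2 \<phi> xs = 0"] CE_diff_2_other by metis
  show ?thesis
    unfolding CE_cocycles_def CE_diff_2 mem_Collect_eq cochains_2_iff cocycle2_def cocycle2_axioms_def
      S_over_simps eq CE_diff_2
    by (insert char2_algebra_axioms, (intro iffI; elim conjE; intro conjI; assumption))
qed

end

section \<open>The first cohomology space\<close>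

context char2_algebra
begin

interpretation S3: vector_space "scale3 s" by (rule vector_space_scale3)

lemma basis_split: "(a, b, c) = e a + (h b + f (c :: 'a))" by simp

text \<open>
  The eight other matrix entries of \<open>D\<close> satisfy functional equations as well: those of degree \<open>\<plusminus>2\<close>
  are multiples of their value at \<open>1\<close>, those of degree \<open>\<plusminus>1\<close> come in two equal pairs, and the diagonal
  ones differ from \<open>\<delta>\<close> by one common multiple of the identity. When the three invariants
  vanish, what remains is the bracket with \<open>(v 1, p 1, v' 1)\<close>.
\<close>
lemma derivation_h_part:
  assumes add: "\<And>x y. D (x + y) = D x + D y" and scl: "\<And>c x. D (scale3 s c x) = scale3 s c (D x)"
    and der: "\<And>x y. cobound D x y = 0"
  defines "\<delta> \<equiv> \<lambda>a. h_part (D (h a))"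
  shows "\<delta> (a + b) = \<delta> a + \<delta> b" "\<delta> (s c a) = s c (\<delta> a)" "\<delta> (a * b) = a * \<delta> b + \<delta> a * b"
    and "\<lbrakk>e_part (D (f 1)) = 0; f_part (D (e 1)) = 0; \<And>a. \<delta> a = 0\<rbrakk> \<Longrightarrow> \<exists>z. \<forall>x. D x = bracket3 x z"
proof -
  define p r u v w u' v' w' where
    p: "p a = e_part (D (e a))" and r: "r a = f_part (D (f a))"
    and u: "u a = h_part (D (f a))" and v: "v a = e_part (D (h a))" and w: "w a = e_part (D (f a))"
    and u': "u' a = h_part (D (e a))" and v': "v' a = f_part (D (h a))" and w': "w' a = f_part (D (e a))" for a
  note comps = p r u v w u' v' w' \<delta>_def
  have D0: "D (0, 0, 0) = 0" using add[of 0 0] by (simp add: zero3)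
  have fh_e: "b * w a + w (a * b) = 0" for a b
    using arg_cong[OF der[of "f a" "h b"], of "\<lambda>v. e_part v"]
    by (simp add: cobound_def bracket3_def comps D0 ac_simps)
  have fh_h: "a * v b + u (a * b) = 0" for a b
    using arg_cong[OF der[of "f a" "h b"], of "\<lambda>v. h_part v"]
    by (simp add: cobound_def bracket3_def comps D0 ac_simps)
  have fh_f: "a * \<delta> b + b * r a + r (a * b) = 0" for a b
    using arg_cong[OF der[of "f a" "h b"], of "\<lambda>v. f_part v"]
    by (simp add: cobound_def bracket3_def comps D0 ac_simps)
  have eh_f: "b * w' a + w' (a * b) = 0" for a b
    using arg_cong[OF der[of "e a" "h b"], of "\<lambda>v. f_part v"]
    by (simp add: cobound_def bracket3_def comps D0 ac_simps)
  have eh_h: "a * v' b + u' (a * b) = 0" for a b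
    using arg_cong[OF der[of "e a" "h b"], of "\<lambda>v. h_part v"]
    by (simp add: cobound_def bracket3_def comps D0 ac_simps)
  have eh_e: "a * \<delta> b + b * p a + p (a * b) = 0" for a b
    using arg_cong[OF der[of "e a" "h b"], of "\<lambda>v. e_part v"]
    by (simp add: cobound_def bracket3_def comps D0 ac_simps)
  have ef_e: "a * u b + v (a * b) = 0" for a b
    using arg_cong[OF der[of "e a" "f b"], of "\<lambda>v. e_part v"]
    by (simp add: cobound_def bracket3_def comps D0 ac_simps)
  have ef_f: "b * u' a + v' (a * b) = 0" for a b
    using arg_cong[OF der[of "e a" "f b"], of "\<lambda>v. f_part v"]
    by (simp add: cobound_def bracket3_def comps D0 ac_simps)
  have ef_h: "a * r b + b * p a + \<delta> (a * b) = 0" for a b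
    using arg_cong[OF der[of "e a" "f b"], of "\<lambda>v. h_part v"]
    by (simp add: cobound_def bracket3_def comps D0 ac_simps)
  have \<delta>1: "\<delta> 1 = 0" using eh_e[of 1 1] by (simp add: add.assoc)
  have p0: "p b = \<delta> b + b * p 1" for b
    by (rule sum_zeroD) (use eh_e[of 1 b] in \<open>simp add: ac_simps\<close>)
  have r0: "r b = \<delta> b + b * r 1" for b
    by (rule sum_zeroD) (use fh_f[of 1 b] in \<open>simp add: ac_simps\<close>)
  have pr: "r 1 = p 1"
    by (rule sum_zeroD) (use ef_h[of 1 1] \<delta>1 in \<open>simp add: ac_simps\<close>)
  show "\<delta> (a + b) = \<delta> a + \<delta> b" "\<delta> (s c a) = s c (\<delta> a)"
    using add[of "h a" "h b"] scl[of c "h a"] by (simp_all add: \<delta>_def scale3_def)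
  show "\<delta> (a * b) = a * \<delta> b + \<delta> a * b"
    by (rule sum_zeroD) (use ef_h[of a b] in \<open>simp add: p0[of a] r0[of b] pr algebra_simps\<close>)
  assume zero: "e_part (D (f 1)) = 0" "f_part (D (e 1)) = 0" "\<And>a. \<delta> a = 0"
  have w0: "w b = 0" "w' b = 0" for b
    using fh_e[of b 1] eh_f[of b 1] zero by (simp_all add: w w')
  have uv: "u b = b * v 1" "v b = b * v 1" for b
  proof -
    show u0: "u b = b * v 1" for b
      by (rule sum_zeroD) (use fh_h[of b 1] in \<open>simp add: ac_simps\<close>)
    show "v b = b * v 1"
      by (rule sum_zeroD) (use ef_e[of b 1] u0[of 1] in \<open>simp add: ac_simps\<close>)
  qed
  have uv': "u' b = b * v' 1" "v' b = b * v' 1" for b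
  proof -
    show u0: "u' b = b * v' 1" for b
      by (rule sum_zeroD) (use eh_h[of b 1] in \<open>simp add: ac_simps\<close>)
    show "v' b = b * v' 1"
      by (rule sum_zeroD) (use ef_f[of b 1] u0[of 1] in \<open>simp add: ac_simps\<close>)
  qed
  have "D (a, b, c) = bracket3 (a, b, c) (v 1, p 1, v' 1)" for a b c
  proof -
    have De: "D (e a) = (a * p 1, a * v' 1, 0)" for a
      using p0[of a] uv'(1)[of a] w0(2)[of a] zero(3)[of a] by (intro triple_eqI) (simp_all add: p u' w')
    have Dh: "D (h a) = (a * v 1, 0, a * v' 1)" for a
      using uv(2)[of a] uv'(2)[of a] zero(3)[of a] by (intro triple_eqI) (simp_all add: v v' \<delta>_def)
    have Df: "D (f a) = (0, a * v 1, a * p 1)" for a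
      using r0[of a] uv(1)[of a] w0(1)[of a] zero(3)[of a] by (intro triple_eqI) (simp_all add: r u w pr[unfolded r])
    have "D (a, b, c) = D (e a) + (D (h b) + D (f c))"
      by (subst basis_split) (simp only: add)
    then show ?thesis by (simp add: De Dh Df bracket3_def ac_simps)
  qed
  then show "\<exists>z. \<forall>x. D x = bracket3 x z" by (intro exI[of _ "(v 1, p 1, v' 1)"] allI) (metis prod.collapse)
qed

end

context char2_algebra
begin

\<comment> \<open>The degree 1 is kept as a numeral, in the form in which the lemmas mention it.\<close>
declare One_nat_def [simp del]

interpretation S3: vector_space "scale3 s" by (rule vector_space_scale3)

lemma coboundaries_1: "CE_coboundaries L 1 = {\<lambda>xs. if length xs = 1 then bracket3 (xs ! 0) z else 0 | z. True}"
proof -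
  have "\<exists>\<phi>\<in>carr (cochains L 0). CE_diff L 0 \<phi> = (\<lambda>xs. if length xs = 1 then bracket3 (xs ! 0) z else 0)" for z
    by (rule bexI[of _ "\<lambda>xs. if xs = [] then z else 0"]) (simp_all add: CE_diff_0 cochains_0_iff)
  then show ?thesis
    by (auto simp: CE_coboundaries_def One_nat_def image_iff CE_diff_0) metis
qed

lemma coboundaries_2: "CE_coboundaries L 2 = {\<lambda>xs. if length xs = 2 then cobound \<omega> (xs ! 0) (xs ! 1) else 0 | \<omega>.
    (\<forall>x y. \<omega> (x + y) = \<omega> x + \<omega> y) \<and> (\<forall>c x. \<omega> (scale3 s c x) = scale3 s c (\<omega> x))}" (is "_ = ?R")
proof -
  have "CE_coboundaries L 2 = CE_diff L 1 ` carr (cochains L 1)"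
    by (simp add: CE_coboundaries_def numeral_2_eq_2 One_nat_def)
  also have "\<dots> = ?R"
  proof
    show "CE_diff L 1 ` carr (cochains L 1) \<subseteq> ?R"
    proof
      fix \<psi> assume "\<psi> \<in> CE_diff L 1 ` carr (cochains L 1)"
      then obtain \<phi> where "\<phi> \<in> carr (cochains L 1)" "\<psi> = CE_diff L 1 \<phi>" by blast
      then show "\<psi> \<in> ?R"
        unfolding cochains_1_iff CE_diff_1 by (intro CollectI exI[of _ "\<lambda>x. \<phi> [x]"]) auto
    qed
    show "?R \<subseteq> CE_diff L 1 ` carr (cochains L 1)"
    proof
      fix \<psi> assume "\<psi> \<in> ?R"
      then obtain \<omega> where *: "\<psi> = (\<lambda>xs. if length xs = 2 then cobound \<omega> (xs ! 0) (xs ! 1) else 0)"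
        "\<forall>x y. \<omega> (x + y) = \<omega> x + \<omega> y" "\<forall>c x. \<omega> (scale3 s c x) = scale3 s c (\<omega> x)" by blast
      let ?\<phi> = "\<lambda>xs. if length xs = 1 then \<omega> (xs ! 0) else 0"
      have "?\<phi> \<in> carr (cochains L 1)" using * unfolding cochains_1_iff by (simp add: One_nat_def)
      moreover have "(\<lambda>x. ?\<phi> [x]) = \<omega>" by (simp add: One_nat_def)
      then have "CE_diff L 1 ?\<phi> = \<psi>" unfolding CE_diff_1 *(1) by (simp only:)
      ultimately show "\<psi> \<in> CE_diff L 1 ` carr (cochains L 1)" by blast
    qed
  qed
  finally show ?thesis .
qed

lemma cobound_linear:
  "cobound (\<lambda>x. \<phi> x + \<psi> x) x y = cobound \<phi> x y + cobound \<psi> x y"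
  "cobound (\<lambda>x. scale3 s c (\<phi> x)) x y = scale3 s c (cobound \<phi> x y)"
  "cobound (\<lambda>x. 0 :: 'a \<times> 'a \<times> 'a) x y = 0"
  by (simp_all add: cobound_def bracket_add_right bracket_scale_right S3.scale_right_distrib ac_simps)

lemma subspace_cocycles_1: "module.subspace scale_fun (CE_cocycles L 1)"
proof (rule module.subspaceI[OF module_scale_fun])
  show "0 \<in> CE_cocycles L 1" unfolding cocycles_1_iff cochains_1_iff by (simp add: cobound_linear)
next
  fix \<phi> \<psi> assume "\<phi> \<in> CE_cocycles L 1" "\<psi> \<in> CE_cocycles L 1"
  then show "\<phi> + \<psi> \<in> CE_cocycles L 1"
    unfolding cocycles_1_iff cochains_1_iff by (simp add: cobound_linear S3.scale_right_distrib ac_simps)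
next
  fix c \<phi> assume "\<phi> \<in> CE_cocycles L 1"
  then show "scale_fun c \<phi> \<in> CE_cocycles L 1"
    unfolding cocycles_1_iff cochains_1_iff by (simp add: cobound_linear S3.scale_right_distrib mult.commute)
qed

lemma coboundaries_1_subset: "CE_coboundaries L 1 \<subseteq> CE_cocycles L 1"
proof -
  have J: "bracket3 x (bracket3 y z) + bracket3 y (bracket3 x z) + bracket3 (bracket3 x y) z = 0" for x y z :: "'a \<times> 'a \<times> 'a"
    by (simp add: jacobi)
  show ?thesis
    unfolding coboundaries_1 subset_iff mem_Collect_eq cocycles_1_iff cochains_1_iff
    by (intro allI impI, elim exE conjE) (simp add: cobound_def bracket_add_left bracket_scale_left One_nat_def J)
qed

definition derivation_class :: "(('a \<times> 'a \<times> 'a) list \<Rightarrow> 'a \<times> 'a \<times> 'a) \<Rightarrow> ('a \<times> 'a) \<times> ('a \<Rightarrow> 'a)" where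
  "derivation_class \<phi> = ((e_part (\<phi> [f 1]), f_part (\<phi> [e 1])), \<lambda>a. h_part (\<phi> [h a]))"

text \<open>
  A right inverse of \<open>derivation_class\<close>, with values in derivations.
\<close>
definition derivation_of :: "('a \<times> 'a) \<times> ('a \<Rightarrow> 'a) \<Rightarrow> 'a \<times> 'a \<times> 'a \<Rightarrow> 'a \<times> 'a \<times> 'a" where
  "derivation_of w x = (fst (fst w) * f_part x + snd w (e_part x), snd w (h_part x),
     snd (fst w) * e_part x + snd w (f_part x))"

abbreviation target1 where "target1 \<equiv> class_vs (scale2 s) UNIV \<oplus>\<^sub>K Har1 s"

lemma Har1_iff: "\<delta> \<in> carr (Har1 s) \<longleftrightarrow> (\<forall>a b. \<delta> (a + b) = \<delta> a + \<delta> b) \<and> (\<forall>c a. \<delta> (s c a) = s c (\<delta> a)) \<and>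
    (\<forall>a b. \<delta> (a * b) = a * \<delta> b + \<delta> a * b)"
  by (simp add: Har1_def linear_scale_iff)

theorem S_over_cohomology_1:
  "vs_isom (\<lambda>w. {\<phi> \<in> CE_cocycles L 1. derivation_class \<phi> = w}) target1 (CE_cohomology L 1)"
  unfolding CE_cohomology_eq
proof (rule fibres_vs_isom_quotient[OF module_scale_fun subspace_cocycles_1 coboundaries_1_subset])
  have closed: "derivation_class \<phi> \<in> carr target1" if "\<phi> \<in> CE_cocycles L 1" for \<phi>
    using that derivation_h_part(1-3)[of "\<lambda>x. \<phi> [x]"]
    by (simp add: cocycles_1_iff cochains_1_iff derivation_class_def Har1_iff)
  have onto: "\<exists>\<phi>\<in>CE_cocycles L 1. derivation_class \<phi> = w" if "w \<in> carr target1" for w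
  proof -
    obtain \<alpha> \<gamma> \<delta> where w: "w = ((\<alpha>, \<gamma>), \<delta>)" by (metis prod.collapse)
    have \<delta>: "\<delta> (a + b) = \<delta> a + \<delta> b" "\<delta> (s c a) = s c (\<delta> a)" "\<delta> (a * b) = a * \<delta> b + \<delta> a * b" for a b c
      using that unfolding w by (simp_all add: Har1_iff)
    have zero: "\<delta> 0 = 0" "\<delta> 1 = 0" using \<delta>(1)[of 0 0] \<delta>(3)[of 1 1] by simp_all
    let ?\<phi> = "\<lambda>xs. if length xs = 1 then derivation_of w (xs ! 0) else 0"
    have "?\<phi> \<in> CE_cocycles L 1"
      unfolding cocycles_1_iff cochains_1_iff
      by (simp add: cobound_def bracket3_def derivation_of_def w \<delta> zero
          One_nat_def scale3_def scale_right_distrib scale_mult_right zero_prod_def algebra_simps)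
    moreover have "derivation_class ?\<phi> = w"
      by (simp add: derivation_class_def derivation_of_def w zero One_nat_def)
    ultimately show ?thesis by blast
  qed
  show "derivation_class ` CE_cocycles L 1 = carr target1"
    using closed onto by (metis (no_types, lifting) image_eqI image_subsetI subsetI subset_antisym)
next
  fix \<phi> \<psi> assume \<phi>: "\<phi> \<in> CE_cocycles L 1" and \<psi>: "\<psi> \<in> CE_cocycles L 1"
  show "derivation_class (\<phi> + \<psi>) = add target1 (derivation_class \<phi>) (derivation_class \<psi>)"
    by (simp add: derivation_class_def Har1_def fun_eq_iff)
  have d: "\<phi> - \<psi> \<in> CE_cocycles L 1"
    using module.subspace_diff[OF module_scale_fun subspace_cocycles_1 \<phi> \<psi>] .
  show "derivation_class \<phi> = derivation_class \<psi> \<longleftrightarrow> \<phi> - \<psi> \<in> CE_coboundaries L 1"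
  proof
    assume eq: "derivation_class \<phi> = derivation_class \<psi>"
    then have "\<forall>a. h_part (\<phi> [h a]) = h_part (\<psi> [h a])"
      unfolding derivation_class_def prod.inject fun_eq_iff by blast
    then obtain z where z: "(\<phi> - \<psi>) [x] = bracket3 x z" for x
      using derivation_h_part(4)[of "\<lambda>x. (\<phi> - \<psi>) [x]"] d eq
      unfolding cocycles_1_iff cochains_1_iff derivation_class_def by auto
    have "\<phi> - \<psi> = (\<lambda>xs. if length xs = 1 then bracket3 (xs ! 0) z else 0)"
    proof
      fix xs show "(\<phi> - \<psi>) xs = (if length xs = 1 then bracket3 (xs ! 0) z else 0)"
      proof (cases "length xs = 1")
        case True
        then obtain x where "xs = [x]" by (auto simp: One_nat_def length_Suc_conv)
        then show ?thesis using z by (simp add: One_nat_def)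
      next
        case False
        then show ?thesis using d unfolding cocycles_1_iff cochains_1_iff by simp
      qed
    qed
    then show "\<phi> - \<psi> \<in> CE_coboundaries L 1" unfolding coboundaries_1 by blast
  next
    assume "\<phi> - \<psi> \<in> CE_coboundaries L 1"
    then obtain z where z: "\<phi> - \<psi> = (\<lambda>xs. if length xs = 1 then bracket3 (xs ! 0) z else 0)"
      unfolding coboundaries_1 by blast
    have "\<phi> [x] = \<psi> [x] + bracket3 x z" for x
      using fun_cong[OF z, of "[x]"] by (simp add: One_nat_def) (metis add_self_left3 add.commute)
    then show "derivation_class \<phi> = derivation_class \<psi>"
      by (simp add: derivation_class_def bracket3_def)
  qed
next
  fix c \<phi>
  show "derivation_class (scale_fun c \<phi>) = scl target1 c (derivation_class \<phi>)"
    by (simp add: derivation_class_def scale2_def Har1_def)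
qed

end

section \<open>The second cohomology space\<close>

context char2_algebra
begin

interpretation S3: vector_space "scale3 s" by (rule vector_space_scale3)

abbreviation scale_bi where "scale_bi \<equiv> \<lambda>c (\<beta> :: 'a \<Rightarrow> 'a \<Rightarrow> 'a) a b. s c (\<beta> a b)"
abbreviation Har2_coset where "Har2_coset \<equiv> coset (class_vs scale_bi (Har2_cocycles s)) (Har2_coboundaries s)"

lemma module_scale_bi: "module scale_bi"
  by standard (simp_all add: fun_eq_iff scale_right_distrib scale_left_distrib)

lemma subspace_Har2_cocycles: "module.subspace scale_bi (Har2_cocycles s)"
proof (rule module.subspaceI[OF module_scale_bi])
  show "0 \<in> Har2_cocycles s" by (simp add: Har2_cocycles_def linear_scale_iff)
next
  fix \<beta> \<beta>' assume *: "\<beta> \<in> Har2_cocycles s" "\<beta>' \<in> Har2_cocycles s"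
  have "a * (\<beta> b c + \<beta>' b c) + (\<beta> (a * b) c + \<beta>' (a * b) c) + (\<beta> a (b * c) + \<beta>' a (b * c))
      + (\<beta> a b + \<beta>' a b) * c = 0" for a b c
  proof -
    have "a * \<beta> b c + \<beta> (a * b) c + \<beta> a (b * c) + \<beta> a b * c = 0"
      "a * \<beta>' b c + \<beta>' (a * b) c + \<beta>' a (b * c) + \<beta>' a b * c = 0"
      using * by (auto simp: Har2_cocycles_def)
    then have "(a * \<beta> b c + \<beta> (a * b) c + \<beta> a (b * c) + \<beta> a b * c)
      + (a * \<beta>' b c + \<beta>' (a * b) c + \<beta>' a (b * c) + \<beta>' a b * c) = 0" by (simp only: add_0_left)
    then show ?thesis by (simp add: algebra_simps)
  qed
  moreover have "\<beta> a b + \<beta>' a b = \<beta> b a + \<beta>' b a" for a b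
    using * by (auto simp: Har2_cocycles_def)
  ultimately show "\<beta> + \<beta>' \<in> Har2_cocycles s"
    using * by (simp add: Har2_cocycles_def linear_scale_iff scale_right_distrib ac_simps)
next
  fix c \<beta> assume *: "\<beta> \<in> Har2_cocycles s"
  have "s c (a * \<beta> b d + \<beta> (a * b) d + \<beta> a (b * d) + \<beta> a b * d) = 0" for a b d
    using * by (auto simp: Har2_cocycles_def)
  then have "a * s c (\<beta> b d) + s c (\<beta> (a * b) d) + s c (\<beta> a (b * d)) + s c (\<beta> a b) * d = 0" for a b d
    by (simp only: scale_right_distrib scale_mult_left[symmetric] scale_mult_right[symmetric])
  moreover have "s c (\<beta> a b) = s c (\<beta> b a)" for a b
    using * by (auto simp: Har2_cocycles_def)
  ultimately show "scale_bi c \<beta> \<in> Har2_cocycles s"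
    using * by (simp add: Har2_cocycles_def linear_scale_iff scale_right_distrib mult.commute)
qed

lemma Har2_coboundaries_iff: "\<beta> \<in> Har2_coboundaries s \<longleftrightarrow>
    (\<exists>\<omega>. (\<forall>a b. \<omega> (a + b) = \<omega> a + \<omega> b) \<and> (\<forall>c a. \<omega> (s c a) = s c (\<omega> a)) \<and>
      \<beta> = (\<lambda>a b. a * \<omega> b + \<omega> (a * b) + \<omega> a * b))"
  by (auto simp: Har2_coboundaries_def linear_scale_iff)

lemma subspace_Har2_coboundaries: "module.subspace scale_bi (Har2_coboundaries s)"
proof (rule module.subspaceI[OF module_scale_bi])
  show "0 \<in> Har2_coboundaries s"
    unfolding Har2_coboundaries_iff by (rule exI[of _ "\<lambda>a. 0"]) (simp add: fun_eq_iff)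
next
  fix \<beta> \<beta>' assume "\<beta> \<in> Har2_coboundaries s" "\<beta>' \<in> Har2_coboundaries s"
  then obtain \<omega> \<omega>' where
    *: "\<forall>a b. \<omega> (a + b) = \<omega> a + \<omega> b" "\<forall>c a. \<omega> (s c a) = s c (\<omega> a)" "\<beta> = (\<lambda>a b. a * \<omega> b + \<omega> (a * b) + \<omega> a * b)"
    "\<forall>a b. \<omega>' (a + b) = \<omega>' a + \<omega>' b" "\<forall>c a. \<omega>' (s c a) = s c (\<omega>' a)" "\<beta>' = (\<lambda>a b. a * \<omega>' b + \<omega>' (a * b) + \<omega>' a * b)"
    unfolding Har2_coboundaries_iff by blast
  then show "\<beta> + \<beta>' \<in> Har2_coboundaries s"
    unfolding Har2_coboundaries_iff
    by (intro exI[of _ "\<lambda>a. \<omega> a + \<omega>' a"]) (simp add: fun_eq_iff scale_right_distrib algebra_simps)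
next
  fix c \<beta> assume "\<beta> \<in> Har2_coboundaries s"
  then obtain \<omega> where
    *: "\<forall>a b. \<omega> (a + b) = \<omega> a + \<omega> b" "\<forall>c a. \<omega> (s c a) = s c (\<omega> a)" "\<beta> = (\<lambda>a b. a * \<omega> b + \<omega> (a * b) + \<omega> a * b)"
    unfolding Har2_coboundaries_iff by blast
  then show "scale_bi c \<beta> \<in> Har2_coboundaries s"
    unfolding Har2_coboundaries_iff
    by (intro exI[of _ "\<lambda>a. s c (\<omega> a)"])
      (simp add: fun_eq_iff scale_right_distrib mult.commute[of c] flip: scale_mult_left scale_mult_right)
qed

lemma scale_cocycle:
  assumes "cocycle2 s \<psi>"
  shows "cocycle2 s (\<lambda>x y. scale3 s c (\<psi> x y))"
proof -
  interpret A: cocycle2 s \<psi> by fact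
  show ?thesis
  proof
    fix x y z
    show "bracket3 x (scale3 s c (\<psi> y z)) + bracket3 y (scale3 s c (\<psi> x z)) + bracket3 z (scale3 s c (\<psi> x y))
      + scale3 s c (\<psi> (bracket3 x y) z) + scale3 s c (\<psi> (bracket3 x z) y) + scale3 s c (\<psi> (bracket3 y z) x) = 0"
      using arg_cong[OF A.cocycle[of x y z], of "scale3 s c"]
      by (simp add: bracket_scale_right S3.scale_right_distrib)
  qed (simp_all add: A.add_left A.add_right A.scl_left A.scl_right A.alt S3.scale_right_distrib S3.scale_left_commute mult.commute)
qed

lemma zero_cocycle: "cocycle2 s (\<lambda>x y. 0)"
proof -
  have "cobound (\<lambda>x. 0 :: 'a \<times> 'a \<times> 'a) = (\<lambda>x y. 0)" by (simp add: fun_eq_iff cobound_def)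
  then show ?thesis using cobound_cocycle[of "\<lambda>x. 0"] by simp
qed

lemma subspace_cocycles_2: "module.subspace scale_fun (CE_cocycles L 2)"
proof (rule module.subspaceI[OF module_scale_fun])
  show "0 \<in> CE_cocycles L 2" unfolding cocycles_2_iff by (simp add: zero_cocycle)
next
  fix \<phi> \<psi> assume "\<phi> \<in> CE_cocycles L 2" "\<psi> \<in> CE_cocycles L 2"
  then show "\<phi> + \<psi> \<in> CE_cocycles L 2" unfolding cocycles_2_iff by (simp add: add_cocycle)
next
  fix c \<phi> assume "\<phi> \<in> CE_cocycles L 2"
  then show "scale_fun c \<phi> \<in> CE_cocycles L 2" unfolding cocycles_2_iff by (simp add: scale_cocycle)
qed

lemma coboundaries_2_subset: "CE_coboundaries L 2 \<subseteq> CE_cocycles L 2"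
  unfolding coboundaries_2 subset_iff mem_Collect_eq cocycles_2_iff
  by (intro allI impI, elim exE conjE) (simp add: cobound_cocycle)

text \<open>
  Multiples of the two outer classes: \<open>f, h \<mapsto> \<alpha> e\<close> and \<open>e, h \<mapsto> \<gamma> f\<close>.
\<close>
definition outer_cocycle :: "'a \<Rightarrow> 'a \<Rightarrow> 'a \<times> 'a \<times> 'a \<Rightarrow> 'a \<times> 'a \<times> 'a \<Rightarrow> 'a \<times> 'a \<times> 'a" where
  "outer_cocycle \<alpha> \<gamma> x y = (\<alpha> * f_part (bracket3 x y), 0, \<gamma> * e_part (bracket3 x y))"

lemma outer_cocycle2: "cocycle2 s (outer_cocycle \<alpha> \<gamma>)"
proof
  fix x y z :: "'a \<times> 'a \<times> 'a"
  show "bracket3 x (outer_cocycle \<alpha> \<gamma> y z) + bracket3 y (outer_cocycle \<alpha> \<gamma> x z) + bracket3 z (outer_cocycle \<alpha> \<gamma> x y)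
      + outer_cocycle \<alpha> \<gamma> (bracket3 x y) z + outer_cocycle \<alpha> \<gamma> (bracket3 x z) y + outer_cocycle \<alpha> \<gamma> (bracket3 y z) x = 0"
    by (rule triple_eqI) (simp_all add: outer_cocycle_def bracket3_def algebra_simps)
qed (simp_all add: triple_eqI outer_cocycle_def bracket_add_left bracket_add_right bracket_scale_left
    bracket_scale_right distrib_left scale_mult_right zero_prod_def)

definition cocycle_class where
  "cocycle_class \<phi> = ((e_part (\<phi> [f 1, h 1]), f_part (\<phi> [e 1, h 1])), Har2_coset (harrison (\<lambda>x y. \<phi> [x, y])))"

abbreviation target2 where "target2 \<equiv> class_vs (scale2 s) UNIV \<oplus>\<^sub>K Har2 s"

lemma harrison_linear:
  "harrison (\<lambda>x y. \<phi> x y + \<psi> x y) = harrison \<phi> + harrison (\<psi> :: 'a \<times> 'a \<times> 'a \<Rightarrow> 'a \<times> 'a \<times> 'a \<Rightarrow> 'a \<times> 'a \<times> 'a)"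
  "harrison (\<lambda>x y. scale3 s c (\<phi> x y)) = scale_bi c (harrison \<phi>)"
  by (simp_all add: harrison_def fun_eq_iff distrib_left ac_simps scale_right_distrib
     flip: scale_mult_right)

text \<open>
  Only the part \<open>h \<mapsto> h\<close> of \<open>\<omega>\<close> survives in \<open>harrison\<close>. The term with \<open>\<omega>(h)\<close> accounts for the
  normalisation at \<open>1\<close>.
\<close>
lemma harrison_cobound:
  assumes add: "\<And>x y. \<omega> (x + y) = \<omega> x + \<omega> y" and scl: "\<And>c x. \<omega> (scale3 s c x) = scale3 s c (\<omega> x)"
  shows "harrison (cobound \<omega>) \<in> Har2_coboundaries s"
  unfolding Har2_coboundaries_iff
proof (intro exI[of _ "\<lambda>a. h_part (\<omega> (h a)) + a * h_part (\<omega> (h 1))"] conjI allI)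
  fix a b c
  have "h (a + b) = h a + h b" "h (s c a) = scale3 s c (h a)" by (simp_all add: scale3_def)
  then show "h_part (\<omega> (h (a + b))) + (a + b) * h_part (\<omega> (h 1))
    = h_part (\<omega> (h a)) + a * h_part (\<omega> (h 1)) + (h_part (\<omega> (h b)) + b * h_part (\<omega> (h 1)))"
    "h_part (\<omega> (h (s c a))) + s c a * h_part (\<omega> (h 1)) = s c (h_part (\<omega> (h a)) + a * h_part (\<omega> (h 1)))"
    by (simp_all add: add scl scale_right_distrib scale_mult_left algebra_simps del: add_Pair)
qed (simp add: harrison_def cobound_def bracket3_def fun_eq_iff algebra_simps)

text \<open>
  Surjectivity onto \<open>Har\<^sup>2\<close> holds only for classes: \<open>harrison\<close> sends the twisted bracket of \<open>\<beta>\<close> not to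
  \<open>\<beta>\<close> but to \<open>\<beta>(a, b) + a b \<beta>(1, 1)\<close>, which differs from \<open>\<beta>\<close> by a coboundary.
\<close>
theorem S_over_cohomology_2:
  "vs_isom (\<lambda>w. {\<phi> \<in> CE_cocycles L 2. cocycle_class \<phi> = w}) target2 (CE_cohomology L 2)"
  unfolding CE_cohomology_eq
proof (rule fibres_vs_isom_quotient[OF module_scale_fun subspace_cocycles_2 coboundaries_2_subset])
  have closed: "cocycle_class \<phi> \<in> carr target2" if "\<phi> \<in> CE_cocycles L 2" for \<phi>
    using that cocycle2.harrison_cocycle unfolding cocycles_2_iff by (auto simp: cocycle_class_def Har2_def)
  have onto: "\<exists>\<phi>\<in>CE_cocycles L 2. cocycle_class \<phi> = w" if w_in: "w \<in> carr target2" for w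
  proof -
    obtain \<alpha> \<gamma> B where w: "w = ((\<alpha>, \<gamma>), B)" by (metis prod.collapse)
    obtain \<beta> where \<beta>: "\<beta> \<in> Har2_cocycles s" "B = Har2_coset \<beta>"
      using w_in unfolding w by (auto simp: Har2_def)
    have har: "a * \<beta> b c + \<beta> (a * b) c + \<beta> a (b * c) + \<beta> a b * c = 0" and sym: "\<beta> a b = \<beta> b a"
      and lin: "\<beta> a (b + c) = \<beta> a b + \<beta> a c" for a b c
      using \<beta>(1) by (auto simp: Har2_cocycles_def linear_scale_iff)
    have zero: "\<beta> a 0 = 0" "\<beta> 0 a = 0" for a using lin[of a 0 0] sym[of 0 a] by simp_all
    have \<beta>1: "\<beta> 1 b = b * \<beta> 1 1" for b
      by (rule sum_zeroD) (use har[of 1 1 b] in \<open>simp add: ac_simps\<close>)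
    let ?\<psi> = "\<lambda>x y. twisted_bracket \<beta> x y + outer_cocycle \<alpha> \<gamma> x y"
    let ?\<phi> = "\<lambda>xs. if length xs = 2 then ?\<psi> (xs ! 0) (xs ! 1) else 0"
    have eq: "(\<lambda>x y. ?\<phi> [x, y]) = ?\<psi>" by (simp add: One_nat_def)
    have "harrison ?\<psi> a b = \<beta> a b + a * b * \<beta> 1 1" for a b
      by (simp add: harrison_def twisted_bracket_def outer_cocycle_def zero \<beta>1[of b] sym[of a 1] \<beta>1[of a] ac_simps)
    then have "harrison ?\<psi> - \<beta> = (\<lambda>a b. a * b * \<beta> 1 1)"
      by (simp add: fun_eq_iff ac_simps)
    also have "\<dots> \<in> Har2_coboundaries s"
      unfolding Har2_coboundaries_iff
      by (rule exI[of _ "\<lambda>a. a * \<beta> 1 1"]) (simp add: fun_eq_iff scale_mult_left algebra_simps)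
    finally have "Har2_coset (harrison ?\<psi>) = B"
      unfolding \<beta>(2) coset_class_vs_eq_iff[OF module_scale_bi subspace_Har2_coboundaries] .
    moreover have "e_part (?\<psi> (f 1) (h 1)) = \<alpha>" "f_part (?\<psi> (e 1) (h 1)) = \<gamma>"
      by (simp_all add: twisted_bracket_def outer_cocycle_def bracket3_def zero)
    ultimately have "cocycle_class ?\<phi> = w"
      unfolding cocycle_class_def eq w by (simp add: One_nat_def)
    moreover have "?\<phi> \<in> CE_cocycles L 2"
      unfolding cocycles_2_iff eq using add_cocycle[OF twisted_cocycle[OF \<beta>(1)] outer_cocycle2] by simp
    ultimately show ?thesis by blast
  qed
  show "cocycle_class ` CE_cocycles L 2 = carr target2"
    using closed onto by (metis (no_types, lifting) image_eqI image_subsetI subsetI subset_antisym)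
next
  fix \<phi> \<psi> assume \<phi>: "\<phi> \<in> CE_cocycles L 2" and \<psi>: "\<psi> \<in> CE_cocycles L 2"
  show "cocycle_class (\<phi> + \<psi>) = add target2 (cocycle_class \<phi>) (cocycle_class \<psi>)"
    by (simp add: cocycle_class_def Har2_def harrison_linear
        add_coset_class_vs[OF module_scale_bi subspace_Har2_coboundaries] del: quotient_simps)
  have d: "\<phi> - \<psi> \<in> CE_cocycles L 2"
    using module.subspace_diff[OF module_scale_fun subspace_cocycles_2 \<phi> \<psi>] .
  then interpret D: cocycle2 s "\<lambda>x y. (\<phi> - \<psi>) [x, y]" unfolding cocycles_2_iff by simp
  have har_diff: "harrison (\<lambda>x y. (\<phi> - \<psi>) [x, y]) = harrison (\<lambda>x y. \<phi> [x, y]) - harrison (\<lambda>x y. \<psi> [x, y])"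
    by (simp add: harrison_linear fun_eq_iff)
  show "cocycle_class \<phi> = cocycle_class \<psi> \<longleftrightarrow> \<phi> - \<psi> \<in> CE_coboundaries L 2"
  proof
    assume eq: "cocycle_class \<phi> = cocycle_class \<psi>"
    then have "harrison (\<lambda>x y. (\<phi> - \<psi>) [x, y]) \<in> Har2_coboundaries s"
      unfolding har_diff cocycle_class_def prod.inject
        coset_class_vs_eq_iff[OF module_scale_bi subspace_Har2_coboundaries] by blast
    then obtain \<eta> where \<eta>: "\<And>a b. \<eta> (a + b) = \<eta> a + \<eta> b" "\<And>c a. \<eta> (s c a) = s c (\<eta> a)"
      "harrison (\<lambda>x y. (\<phi> - \<psi>) [x, y]) = (\<lambda>a b. a * \<eta> b + \<eta> (a * b) + \<eta> a * b)"
      unfolding Har2_coboundaries_iff by blast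
    \<comment> \<open>The first summand accounts for the twisted bracket of the coboundary of \<open>\<eta>\<close>, the second for
      the normalisation.\<close>
    let ?\<omega> = "\<lambda>x. (\<eta> (e_part x), \<eta> (h_part x), \<eta> (f_part x)) + normaliser (\<lambda>x y. (\<phi> - \<psi>) [x, y]) x"
    have cob: "(\<phi> - \<psi>) [x, y] = cobound ?\<omega> x y" for x y
    proof -
      have "(\<phi> - \<psi>) [x, y] = twisted_bracket (harrison (\<lambda>x y. (\<phi> - \<psi>) [x, y])) x y
        + cobound (normaliser (\<lambda>x y. (\<phi> - \<psi>) [x, y])) x y"
        by (rule D.normal_form) (use eq in \<open>auto simp: cocycle_class_def\<close>)
      then show ?thesis
        unfolding \<eta>(3) twisted_Har2_coboundary[OF \<eta>(1)] by (simp only: cobound_linear(1))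
    qed
    have "(\<phi> - \<psi>) xs = (if length xs = 2 then cobound ?\<omega> (xs ! 0) (xs ! 1) else 0)" for xs
    proof (cases "length xs = 2")
      case True
      then obtain x y where "xs = [x, y]" by (auto simp: numeral_2_eq_2 length_Suc_conv)
      moreover have "[x, y] ! 0 = x" "[x, y] ! 1 = y" by (simp_all add: One_nat_def)
      ultimately show ?thesis using True cob[of x y] by (simp only: if_True refl)
    next
      case False
      then show ?thesis using d unfolding cocycles_2_iff by simp
    qed
    then have "\<phi> - \<psi> = (\<lambda>xs. if length xs = 2 then cobound ?\<omega> (xs ! 0) (xs ! 1) else 0)" by blast
    moreover have "?\<omega> (x + y) = ?\<omega> x + ?\<omega> y" "?\<omega> (scale3 s c x) = scale3 s c (?\<omega> x)" for x y c
      unfolding D.normaliser_add D.normaliser_scale S3.scale_right_distrib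
      by (simp_all add: \<eta>(1,2) scale3_def ac_simps)
    ultimately show "\<phi> - \<psi> \<in> CE_coboundaries L 2" unfolding coboundaries_2 by blast
  next
    assume "\<phi> - \<psi> \<in> CE_coboundaries L 2"
    then obtain \<omega> where \<omega>: "\<phi> - \<psi> = (\<lambda>xs. if length xs = 2 then cobound \<omega> (xs ! 0) (xs ! 1) else 0)"
      "\<And>x y. \<omega> (x + y) = \<omega> x + \<omega> y" "\<And>c x. \<omega> (scale3 s c x) = scale3 s c (\<omega> x)"
      unfolding coboundaries_2 by blast
    have cob: "(\<phi> - \<psi>) [x, y] = cobound \<omega> x y" for x y
      unfolding \<omega>(1) by (simp add: One_nat_def)
    then have "harrison (\<lambda>x y. (\<phi> - \<psi>) [x, y]) = harrison (cobound \<omega>)" by simp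
    also have "\<dots> \<in> Har2_coboundaries s" by (rule harrison_cobound) (rule \<omega>)+
    finally have "harrison (\<lambda>x y. \<phi> [x, y]) - harrison (\<lambda>x y. \<psi> [x, y]) \<in> Har2_coboundaries s"
      unfolding har_diff .
    moreover have "\<phi> [x, y] = \<psi> [x, y] + cobound \<omega> x y" for x y
      using cob[of x y, symmetric] by (simp add: ac_simps)
    then have "e_part (\<phi> [f 1, h 1]) = e_part (\<psi> [f 1, h 1])" "f_part (\<phi> [e 1, h 1]) = f_part (\<psi> [e 1, h 1])"
      by (simp_all add: cobound_def bracket3_def)
    ultimately show "cocycle_class \<phi> = cocycle_class \<psi>"
      unfolding cocycle_class_def prod.inject
        coset_class_vs_eq_iff[OF module_scale_bi subspace_Har2_coboundaries] by blast
  qed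
next
  fix c \<phi>
  show "cocycle_class (scale_fun c \<phi>) = scl target2 c (cocycle_class \<phi>)"
    by (simp add: cocycle_class_def Har2_def harrison_linear scale2_def
        scl_coset_class_vs[OF module_scale_bi subspace_Har2_coboundaries] del: quotient_simps)
qed

end

section \<open>The current Lie algebra in coordinates\<close>

definition basis2 :: "nat \<Rightarrow> 'k::zero_neq_one \<times> 'k" where
  "basis2 i = (if i = 0 then (1, 0) else (0, 1))"

definition coord2 :: "nat \<Rightarrow> 'a \<times> 'a \<Rightarrow> 'a" where
  "coord2 i x = (if i = 0 then fst x else snd x)"

definition basis3 :: "nat \<Rightarrow> 'k::zero_neq_one \<times> 'k \<times> 'k" where
  "basis3 i = (if i = 0 then e 1 else if i = 1 then h 1 else f 1)"

definition coord3 :: "nat \<Rightarrow> 'a \<times> 'a \<times> 'a \<Rightarrow> 'a" where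
  "coord3 i x = (if i = 0 then e_part x else if i = 1 then h_part x else f_part x)"

context vector_space
begin

lemma module_scale2: "module (scale2 scale)" and module_scale3: "module (scale3 scale)"
  by (standard, simp_all add: scale2_def scale3_def scale_right_distrib scale_left_distrib)+

lemma tensor_coordinates_2:
  assumes "vs_isom g (class_vs (scale2 (*)) UNIV) V"
  shows "tensor_coordinates (scale2 (*)) scale (scale2 scale) V g
    (\<lambda>u a. (scale (fst u) a, scale (snd u) a)) {0, 1} basis2 coord2 coord2"
proof -
  interpret K: vector_space "(*) :: 'a \<Rightarrow> 'a \<Rightarrow> 'a" by standard (simp_all add: algebra_simps)
  interpret K2: module "scale2 ((*) :: 'a \<Rightarrow> 'a \<Rightarrow> 'a)" by (rule K.module_scale2)
  interpret S2: module "scale2 scale" by (rule module_scale2)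
  show ?thesis
  proof
    show "vs_isom g (class_vs (scale2 (*)) UNIV) V" by (rule assms)
  qed (simp_all add: scale2_def basis2_def coord2_def, simp_all add: scale_left_distrib scale_right_distrib mult.commute flip: zero_prod_def)
qed

lemma tensor_coordinates_3:
  "tensor_coordinates (scale3 (*)) scale (scale3 scale) (S_over (*)) (\<lambda>x. x)
    (\<lambda>u a. (scale (e_part u) a, scale (h_part u) a, scale (f_part u) a)) {0, 1, 2} basis3 coord3 coord3"
proof -
  interpret K: vector_space "(*) :: 'a \<Rightarrow> 'a \<Rightarrow> 'a" by standard (simp_all add: algebra_simps)
  interpret K3: module "scale3 ((*) :: 'a \<Rightarrow> 'a \<Rightarrow> 'a)" by (rule K.module_scale3)
  interpret S3: module "scale3 scale" by (rule module_scale3)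
  show ?thesis
  proof
    show "vs_isom (\<lambda>x. x) (class_vs (scale3 (*)) UNIV) (S_over ((*) :: 'a \<Rightarrow> _))" by (simp add: vs_isom_def bij_id[unfolded id_def])
  qed (simp_all add: scale3_def basis3_def coord3_def, simp_all add: scale_left_distrib scale_right_distrib mult.commute flip: zero_prod_def)
qed

end

lemma current_simps:
  "carr (current \<L> s) = carr (\<L> \<otimes>\<^sub>K class_vs s UNIV)" "add (current \<L> s) = add (\<L> \<otimes>\<^sub>K class_vs s UNIV)"
  "scl (current \<L> s) = scl (\<L> \<otimes>\<^sub>K class_vs s UNIV)" "zro (current \<L> s) = tensor_rels \<L> (class_vs s UNIV)"
  "brk (current \<L> s) X Y = (\<Union>p\<in>X. \<Union>q\<in>Y.
     coset (free_vs (carr \<L> \<times> UNIV)) (tensor_rels \<L> (class_vs s UNIV)) (free_bracket \<L> p q))"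
  by (simp_all add: current_def Let_def vspace.defs lie_alg.defs tensor_def)

context char2_algebra
begin

interpretation T: tensor_coordinates "scale3 (*)" s "scale3 s" "S_over (*)" "\<lambda>x. x"
  "\<lambda>u a. (s (e_part u) a, s (h_part u) a, s (f_part u) a)" "{0, 1, 2}" basis3 coord3 coord3
  by (rule tensor_coordinates_3)

interpretation S3: vector_space "scale3 s" by (rule vector_space_scale3)

lemma bracket_sum_left: "bracket3 (\<Sum>i\<in>I. u i) x = (\<Sum>i\<in>I. bracket3 (u i) (x :: 'a \<times> 'a \<times> 'a))"
  and bracket_sum_right: "bracket3 x (\<Sum>i\<in>I. u i) = (\<Sum>i\<in>I. bracket3 x (u i :: 'a \<times> 'a \<times> 'a))"
  by (induction I rule: infinite_finite_induct) (simp_all add: bracket_add_left bracket_add_right)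

text \<open>
  The rule \<open>[u \<otimes> a, v \<otimes> b] = [u, v] \<otimes> ab\<close>, which defines the bracket on the free vector space, holds in
  \<open>A\<^sup>3\<close> because the bracket there is \<open>A\<close>-bilinear.
\<close>
lemma contract_free_bracket:
  "T.contract (free_bracket (S_over (*)) p q) = bracket3 (T.contract p) (T.contract q)"
proof -
  have m: "(s (e_part (bracket3 u v)) (a * b), s (h_part (bracket3 u v)) (a * b), s (f_part (bracket3 u v)) (a * b))
    = bracket3 (s (e_part u) a, s (h_part u) a, s (f_part u) a) (s (e_part v) b, s (h_part v) b, s (f_part v) b)"
    for u v :: "'k \<times> 'k \<times> 'k" and a b
    by (simp add: bracket3_def scale_left_distrib scale_left_diff_distrib mult.commute
        flip: scale_mult_left scale_mult_right)
  have T1: "T.contract (Poly_Mapping.single (u, a) c) = scale3 s c (s (e_part u) a, s (h_part u) a, s (f_part u) a)"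
    for u a c by (rule T.contract_single)
  show ?thesis
    unfolding free_bracket_def T.contract_sum T1 S_over_simps m
    by (subst sum.swap) (simp add: T.contract_def T.inv_g T.T.scale_sum_right bracket_sum_left bracket_sum_right bracket_scale_left bracket_scale_right
        mult.commute)
qed

abbreviation model_map where "model_map \<equiv> \<lambda>x. {p \<in> T.free. T.contract p = x}"

text \<open>
  The bracket of two classes is a union over all pairs of representatives; as contraction respects
  brackets, every pair contributes the same fibre.
\<close>
lemma lie_isom_model_map: "lie_isom (S_over s) (current (S_over (*)) s) model_map"
proof -
  note iso = T.fibre_vs_isom_tensor
  have brk: "model_map (bracket3 x y) = brk (current (S_over (*)) s) (model_map x) (model_map y)" for x y
  proof -
    have cos: "coset (free_vs (carr (S_over (*)) \<times> UNIV)) T.rels (free_bracket (S_over (*)) p q) = model_map (bracket3 x y)"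
      if "p \<in> model_map x" "q \<in> model_map y" for p q
      using that T.coset_rels[of "free_bracket (S_over (*)) p q"] by (simp add: contract_free_bracket)
    have ne: "model_map x \<noteq> {}" for x
      using T.representative_free[of x] T.contract_representative[of x] by blast
    show ?thesis
      unfolding current_simps by (rule sym, intro SUP_eq_const ne cos)
  qed
  have "model_map 0 = T.rels"
  proof -
    have "p \<in> T.rels \<longleftrightarrow> T.contract p = 0" for p
      using T.contract_eq_iff[of p 0] by (simp add: T.contract_0)
    then show ?thesis by auto
  qed
  with iso brk show ?thesis
    by unfold_locales (simp_all add: vs_isom_def current_simps(1-4))
qed

end

section \<open>The case of the ground field, and the theorem\<close>

context char2_algebra
begin

lemma vs_closed_Har1: "vs_closed (Har1 s)"
proof -
  have ops: "add (Har1 s) = (+)" "scl (Har1 s) = (\<lambda>c \<delta> a. s c (\<delta> a))" by (simp_all add: Har1_def)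
  show ?thesis unfolding vs_closed_def ops
  proof (intro conjI ballI allI)
    fix \<delta> \<delta>' assume "\<delta> \<in> carr (Har1 s)" "\<delta>' \<in> carr (Har1 s)"
    then show "\<delta> + \<delta>' \<in> carr (Har1 s)"
      unfolding Har1_iff by (simp add: scale_right_distrib algebra_simps)
  next
    fix c \<delta> assume "\<delta> \<in> carr (Har1 s)"
    then show "(\<lambda>a. s c (\<delta> a)) \<in> carr (Har1 s)"
      unfolding Har1_iff
      by (simp add: scale_right_distrib mult.commute[of c] flip: scale_mult_left scale_mult_right)
  qed
qed

lemma vs_closed_Har2: "vs_closed (Har2 s)"
  unfolding Har2_def
  by (rule vs_closed_quotient_class_vs[OF module_scale_bi subspace_Har2_cocycles subspace_Har2_coboundaries])

lemma vs_closed_targets: "vs_closed target1" "vs_closed target2"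
  by (intro vs_closed_direct_sum vs_closed_Har1 vs_closed_Har2; simp add: vs_closed_def)+

end

lemma char2_algebra_field:
  assumes "CHAR('k) = 2"
  shows "char2_algebra ((*) :: 'k \<Rightarrow> 'k \<Rightarrow> 'k::field)"
  by standard (simp_all add: assms algebra_simps)

text \<open>
  A \<open>K\<close>-linear derivation of \<open>K\<close> vanishes because it does so at \<open>1\<close>.
\<close>
lemma Har1_field: "carr (Har1 ((*) :: 'k \<Rightarrow> 'k \<Rightarrow> 'k::field)) = {\<lambda>a. 0}" if "CHAR('k) = 2"
proof -
  interpret char2_algebra "(*) :: 'k \<Rightarrow> 'k \<Rightarrow> 'k" by (rule char2_algebra_field[OF that])
  have "\<delta> a = 0" if "\<delta> \<in> carr (Har1 (*))" for \<delta> and a :: 'k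
  proof -
    have "\<delta> (1 * 1) = 1 * \<delta> 1 + \<delta> 1 * 1" "\<delta> (a * 1) = a * \<delta> 1"
      using that unfolding Har1_iff by blast+
    then show ?thesis by simp
  qed
  moreover have "(\<lambda>a. 0) \<in> carr (Har1 ((*) :: 'k \<Rightarrow> 'k \<Rightarrow> 'k))" unfolding Har1_iff by simp
  ultimately show ?thesis by blast
qed

text \<open>
  A bilinear map on \<open>K\<close> is \<open>a b k\<close> for a constant \<open>k\<close>, and in characteristic 2 this is the coboundary
  of multiplication by \<open>k\<close>.
\<close>
lemma Har2_field:
  assumes "CHAR('k) = 2"
  shows "carr (Har2 ((*) :: 'k \<Rightarrow> 'k \<Rightarrow> 'k::field)) = {char2_algebra.Har2_coset (*) (\<lambda>a b. 0)}"
proof -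
  have coboundary: "a * (b * k) = a * (b * k) + a * b * k + a * k * b" if "\<And>x :: 'k. x + x = 0" for a b k :: 'k
  proof -
    have "a * b * k = a * (b * k)" "a * k * b = a * (b * k)" by (simp_all add: ac_simps)
    then show ?thesis by (simp only: that add_0_left)
  qed
  interpret char2_algebra "(*) :: 'k \<Rightarrow> 'k \<Rightarrow> 'k" by (rule char2_algebra_field[OF assms])
  have "Har2_coset \<beta> = Har2_coset (\<lambda>a b. 0)" if "\<beta> \<in> Har2_cocycles (*)" for \<beta> :: "'k \<Rightarrow> 'k \<Rightarrow> 'k"
    unfolding coset_class_vs_eq_iff[OF module_scale_bi subspace_Har2_coboundaries] Har2_coboundaries_iff
  proof (intro exI[of _ "\<lambda>a. a * \<beta> 1 1"] conjI allI)
    have lin: "\<beta> (c * a) b = c * \<beta> a b" "\<beta> a (c * b) = c * \<beta> a b" for a b c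
      using that by (auto simp: Har2_cocycles_def linear_scale_iff)
    define k where "k = \<beta> 1 1"
    have "\<beta> a b = a * (b * k)" for a b
      using lin(1)[of a 1 b] lin(2)[of 1 b 1] unfolding k_def mult_1_right by (simp only:)
    then show "\<beta> - (\<lambda>a b. 0) = (\<lambda>a b. a * (b * \<beta> 1 1) + a * b * \<beta> 1 1 + a * \<beta> 1 1 * b)"
      unfolding k_def[symmetric] by (intro ext) (simp only: minus_apply diff_zero coboundary[OF add_self, symmetric])
  qed (simp_all only: distrib_right mult.assoc)
  moreover have "(\<lambda>a b. 0) \<in> Har2_cocycles ((*) :: 'k \<Rightarrow> 'k \<Rightarrow> 'k)"
    using module.subspace_0[OF module_scale_bi subspace_Har2_cocycles] by (simp add: zero_fun_def)
  moreover have "carr (Har2 (*)) = Har2_coset ` Har2_cocycles ((*) :: 'k \<Rightarrow> 'k \<Rightarrow> 'k)" by (simp add: Har2_def)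
  ultimately show ?thesis by (metis (no_types, lifting) image_constant image_cong)
qed

lemma S_alg_cohomology:
  assumes "CHAR('k) = 2"
  shows "class_vs (scale2 (*)) UNIV \<cong>\<^sub>K (CE_cohomology (S_alg :: ('k::field, _) lie_alg) 1)"
    and "class_vs (scale2 (*)) UNIV \<cong>\<^sub>K (CE_cohomology (S_alg :: ('k::field, _) lie_alg) 2)"
proof -
  interpret char2_algebra "(*) :: 'k \<Rightarrow> 'k \<Rightarrow> 'k" by (rule char2_algebra_field[OF assms])
  show "class_vs (scale2 (*)) UNIV \<cong>\<^sub>K (CE_cohomology (S_alg :: ('k, _) lie_alg) 1)"
    unfolding S_alg_eq_S_over
    by (rule vs_isoI[OF vs_isom_trans[OF vs_isom_direct_sum_trivial[OF Har1_field[OF assms] vs_closed_Har1] S_over_cohomology_1]])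
  show "class_vs (scale2 (*)) UNIV \<cong>\<^sub>K (CE_cohomology (S_alg :: ('k, _) lie_alg) 2)"
    unfolding S_alg_eq_S_over
    by (rule vs_isoI[OF vs_isom_trans[OF vs_isom_direct_sum_trivial[OF Har2_field[OF assms] vs_closed_Har2] S_over_cohomology_2]])
qed

theorem proposition3p1:
  fixes scaleA :: "'k::field \<Rightarrow> 'a \<Rightarrow> 'a::{comm_ring, comm_monoid_mult}"
  assumes "CHAR('k) = 2"
    and "vector_space scaleA"
    and "\<And>c a b. scaleA c (a * b) = scaleA c a * b"
  shows "CE_cohomology (current S_alg scaleA) 1 \<cong>\<^sub>K
           (CE_cohomology (S_alg :: ('k, _) lie_alg) 1 \<otimes>\<^sub>K class_vs scaleA UNIV) \<oplus>\<^sub>K Har1 scaleA \<and>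
         CE_cohomology (current S_alg scaleA) 2 \<cong>\<^sub>K
           (CE_cohomology (S_alg :: ('k, _) lie_alg) 2 \<otimes>\<^sub>K class_vs scaleA UNIV) \<oplus>\<^sub>K Har2 scaleA"
proof -
  interpret char2_algebra scaleA
    using assms by (intro char2_algebra.intro char2_algebra_axioms.intro)
  interpret M: lie_isom "S_over scaleA" "current S_alg scaleA" model_map
    using lie_isom_model_map unfolding S_alg_eq_S_over .
  have tensor: "class_vs (scale2 scaleA) UNIV \<cong>\<^sub>K (V \<otimes>\<^sub>K class_vs scaleA UNIV)"
    if "class_vs (scale2 (*)) UNIV \<cong>\<^sub>K V" for V
  proof -
    from that obtain g where "vs_isom g (class_vs (scale2 (*)) UNIV) V" unfolding vs_iso_iff ..
    from tensor_coordinates.fibre_vs_isom_tensor[OF tensor_coordinates_2[OF this]] show ?thesis by (rule vs_isoI)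
  qed
  obtain F1 F2 where
    F1: "vs_isom F1 (class_vs (scale2 scaleA) UNIV) (CE_cohomology (S_alg :: ('k, _) lie_alg) 1 \<otimes>\<^sub>K class_vs scaleA UNIV)" and
    F2: "vs_isom F2 (class_vs (scale2 scaleA) UNIV) (CE_cohomology (S_alg :: ('k, _) lie_alg) 2 \<otimes>\<^sub>K class_vs scaleA UNIV)"
    using tensor[OF S_alg_cohomology(1)[OF assms(1)]] tensor[OF S_alg_cohomology(2)[OF assms(1)]] unfolding vs_iso_iff by blast
  show ?thesis
  proof
    show "CE_cohomology (current S_alg scaleA) 1 \<cong>\<^sub>K
      (CE_cohomology (S_alg :: ('k, _) lie_alg) 1 \<otimes>\<^sub>K class_vs scaleA UNIV) \<oplus>\<^sub>K Har1 scaleA"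
      by (rule vs_iso_common_source[OF vs_isom_trans[OF S_over_cohomology_1 M.cohomology_vs_isom]
            vs_isom_direct_sum[OF F1 vs_isom_id] vs_closed_targets(1)])
    show "CE_cohomology (current S_alg scaleA) 2 \<cong>\<^sub>K
      (CE_cohomology (S_alg :: ('k, _) lie_alg) 2 \<otimes>\<^sub>K class_vs scaleA UNIV) \<oplus>\<^sub>K Har2 scaleA"
      by (rule vs_iso_common_source[OF vs_isom_trans[OF S_over_cohomology_2 M.cohomology_vs_isom]
            vs_isom_direct_sum[OF F2 vs_isom_id] vs_closed_targets(2)])
  qed
qed

end
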